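(* Let $n\ge 3$ be an integer, let $K\subset\mathbb{R}^2$ be an $n$-fold rotationally symmetric convex body with $o\in\operatorname{int}K$, let $R_n$ be a regular $n$-gon, and suppose $$|K|\cdot|K^*|\le(1+\varepsilon)\cdot n^2\sin^2(\pi/n),\quad\text{with } \varepsilon>0.$$ Then $\delta_{BM}^s(K,R_n)\le 1+18\,\varepsilon$. Moreover, let $x\in\mathbb{R}^2$ and $\lambda_1,\lambda_2>0$, and let $R_n$ be a regular $n$-gon such that $\lambda_1R_n+x\subset K\subset\lambda_2R_n+x$ and $\lambda_2/\lambda_1\le 1+18\,\varepsilon<1/\cos(\pi/n)\le 2$. Then, in the Euclidean norm for which $[(\lambda_1+\lambda_2)/2]R_n$ is a regular $n$-gon of diameter $1$, the distance of the centre of $[(\lambda_1+\lambda_2)/2]R_n+x$ from $o$ is at most $263\cdot\sqrt{\varepsilon}$.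
   Context: $o$ is the origin of $\mathbb{R}^2$, $\langle\cdot,\cdot\rangle$ the scalar product, $|\cdot|$ denotes area. A convex body is a compact convex set with non-empty interior. $K$ is $n$-fold rotationally symmetric if it is invariant under the rotation through the angle $2\pi/n$ about some point (not necessarily $o$). For a convex body $K$ with $o\in\operatorname{int}K$ the polar is $K^*=\{x\in\mathbb{R}^2:\ \langle x,y\rangle\le 1\ \text{for all } y\in K\}$. For convex bodies $K,L\subset\mathbb{R}^2$, $$\delta_{BM}^s(K,L)=\min\{\lambda_2/\lambda_1:\ \lambda_1,\lambda_2\in(0,\infty),\ \exists\text{ similarity }A,\ \exists x\in\mathbb{R}^2,\ \lambda_1A(K)\subset L\subset\lambda_2A(K)+x\}$$ (the variant of the Banach-Mazur distance in which $A$ ranges only over similarities of $\mathbb{R}^2$). "The Euclidean norm for which a set is a regular $n$-gon of diameter $1$" means the norm on $\mathbb{R}^2$ induced by an inner product with respect to which the given polygon is regular with diameter $1$ (a multiple of the standard norm); the distance in the conclusion is measured in this norm. *)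

theory Defs
  imports "HOL-Analysis.Analysis"
begin

definition convex_body :: "(real^2) set \<Rightarrow> bool" where
  "convex_body K \<longleftrightarrow> compact K \<and> convex K \<and> interior K \<noteq> {}"

definition rotation :: "real \<Rightarrow> real^2 \<Rightarrow> real^2" where
  "rotation t v = vector [cos t * v $ 1 - sin t * v $ 2, sin t * v $ 1 + cos t * v $ 2]"

definition rotationally_symmetric :: "nat \<Rightarrow> (real^2) set \<Rightarrow> bool" where
  "rotationally_symmetric n K \<longleftrightarrow>
     (\<exists>p. (\<lambda>v. p + rotation (2 * pi / real n) (v - p)) ` K = K)"

definition polar :: "(real^2) set \<Rightarrow> (real^2) set" where
  "polar K = {x. \<forall>y\<in>K. x \<bullet> y \<le> 1}"

definition area :: "(real^2) set \<Rightarrow> real" where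
  "area K = measure lebesgue K"

(* Similarities may reverse orientation and need not fix the origin;
   in finite dimension surjectivity is automatic. *)
definition similarity :: "(real^2 \<Rightarrow> real^2) \<Rightarrow> bool" where
  "similarity A \<longleftrightarrow> (\<exists>r>0. \<forall>x y. dist (A x) (A y) = r * dist x y)"

(* For convex bodies K and L the infimum is attained, so it is a minimum. *)
definition BM_sim_dist :: "(real^2) set \<Rightarrow> (real^2) set \<Rightarrow> real" where
  "BM_sim_dist K L = Inf {l2 / l1 | l1 l2. 0 < l1 \<and> 0 < l2 \<and>
     (\<exists>A x. similarity A \<and>
        (\<lambda>y. l1 *\<^sub>R y) ` A ` K \<subseteq> L \<and> L \<subseteq> (\<lambda>y. l2 *\<^sub>R y + x) ` A ` K)}"

definition inner_product :: "(real^2 \<Rightarrow> real^2 \<Rightarrow> real) \<Rightarrow> bool" where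
  "inner_product B \<longleftrightarrow> bilinear B \<and> (\<forall>x y. B x y = B y x) \<and> (\<forall>x. x \<noteq> 0 \<longrightarrow> 0 < B x x)"

definition norm_wrt :: "(real^2 \<Rightarrow> real^2 \<Rightarrow> real) \<Rightarrow> real^2 \<Rightarrow> real" where
  "norm_wrt B x = sqrt (B x x)"

definition diameter_wrt :: "(real^2 \<Rightarrow> real^2 \<Rightarrow> real) \<Rightarrow> (real^2) set \<Rightarrow> real" where
  "diameter_wrt B P = Sup {norm_wrt B (x - y) | x y. x \<in> P \<and> y \<in> P}"

(* The solid n-gon P is regular with centre c, angles and lengths being measured by B:
   its vertices are equally spaced on a B-circle about c.  The B-orthonormal basis (e1, e2)
   is arbitrary, so the first vertex may lie in any direction. *)
definition regular_polygon_at ::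
    "(real^2 \<Rightarrow> real^2 \<Rightarrow> real) \<Rightarrow> nat \<Rightarrow> real^2 \<Rightarrow> (real^2) set \<Rightarrow> bool" where
  "regular_polygon_at B n c P \<longleftrightarrow>
     (\<exists>r e1 e2. 0 < r \<and> B e1 e1 = 1 \<and> B e2 e2 = 1 \<and> B e1 e2 = 0 \<and>
        P = convex hull {c + r *\<^sub>R (cos (2 * pi * real k / real n) *\<^sub>R e1
                                  + sin (2 * pi * real k / real n) *\<^sub>R e2) | k. k < n})"

definition regular_polygon ::
    "(real^2 \<Rightarrow> real^2 \<Rightarrow> real) \<Rightarrow> nat \<Rightarrow> (real^2) set \<Rightarrow> bool" where
  "regular_polygon B n P \<longleftrightarrow> (\<exists>c. regular_polygon_at B n c P)"

end

theory Submission
  imports Defs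
begin

text \<open>
  Write \<open>s = sin (pi / n)\<close>, \<open>c = cos (pi / n)\<close>, let \<open>p\<close> be the centre of the rotational symmetry,
  and scale \<open>K = p + K1\<close> so that the largest norm of a point of \<open>K1\<close> is \<open>1\<close>, attained at \<open>a\<close>.
  The images of \<open>a\<close> under the rotations span a regular \<open>n\<close>-gon inside \<open>K1\<close>, and all of them are
  also points of the polar of \<open>K1\<close>, since \<open>K1\<close> lies in the unit disc.

  \<^emph>\<open>Polygon distance.\<close>  Cut the plane into \<open>n\<close> sectors through the images of \<open>a\<close>, and let \<open>h\<close> be the
  largest value on \<open>K1\<close> of the inner product with the unit vector \<open>e\<close> that bisects the first sector,
  attained at \<open>x\<close>; after a reflection \<open>x\<close> lies on the side of \<open>a\<close>.
  In the sector, \<open>K1\<close> contains the fan over \<open>a\<close>, \<open>x\<close>, \<open>z\<close>, \<open>b\<close>, where \<open>b\<close> is the next image of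
  \<open>a\<close> and \<open>z\<close> is the point of \<open>K1\<close> farthest out beyond the chord from \<open>x\<close> to \<open>b\<close>.  The polar contains
  the fan over \<open>a\<close>, \<open>e / h\<close>, \<open>u\<close>, \<open>b\<close>, where \<open>u\<close> is the normal of that chord, scaled by the maximality
  of \<open>z\<close>.  Moving \<open>z\<close> outward makes the first fan larger and the second one smaller, and the product of
  the two areas stays above \<open>s\<^sup>2 + (1 - c / h) * (1 - c * h) / 4\<close> (\<open>area_product_bound\<close>).  The
  surplus over \<open>s\<^sup>2\<close> is at least a constant multiple of \<open>s\<^sup>2 * (h / c - 1)\<close>, whence \<open>h \<le> (1 + 12 * \<epsilon>) * c\<close>, and \<open>K1\<close> lies in the
  inscribed \<open>n\<close>-gon dilated by \<open>1 + 12 * \<epsilon>\<close> (\<open>sandwich_ngon\<close>).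

  \<^emph>\<open>Centre of polarity.\<close>  The polar of \<open>p + K1\<close> contains the image of the polar of \<open>K1\<close> under the map
  \<open>z \<mapsto> z / (1 + z \<bullet> p)\<close>, whose Jacobian determinant is \<open>(1 + z \<bullet> p) ^ (-3)\<close>.  In its expansion
  at \<open>z \<bullet> p = 0\<close> the linear term integrates to zero by the rotational symmetry, and the quadratic term shows that moving the
  centre by \<open>p\<close> increases the area of the polar by at least a multiple of \<open>(norm p)\<^sup>2\<close>
  (\<open>santalo_stability\<close>).  As \<open>area K1 * area (polar K1)\<close> is never below \<open>n\<^sup>2 * s\<^sup>2\<close>, the
  hypothesis gives \<open>(norm p)\<^sup>2 \<le> 128 * \<epsilon>\<close>.

  \<^emph>\<open>Centre of the polygon.\<close>  If \<open>K\<close> lies between two homothetic regular \<open>n\<close>-gons, averaging over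
  the rotations about \<open>p\<close> shows that the translates of the polygons with centre \<open>p\<close> also
  enclose \<open>K\<close> from inside and outside, so that both centres differ from \<open>p\<close> by at most the
  difference of the circumradii, which is of order \<open>\<epsilon>\<close>.  Finally a polygon of circumradius \<open>r\<close> contains a disc of radius \<open>r / 2\<close>; if its
  diameter for an inner product is \<open>1\<close>, the norm of that inner product is at most the standard
  norm divided by \<open>r\<close> (\<open>norm_wrt_le_of_disc\<close>).
\<close>

section \<open>Determinants and rotations of the plane\<close>

definition det2 :: "real^2 \<Rightarrow> real^2 \<Rightarrow> real" where
  "det2 v w = v$1 * w$2 - v$2 * w$1"

lemma vec2_eq_iff: "(v::real^2) = w \<longleftrightarrow> v$1 = w$1 \<and> v$2 = w$2"
  by (simp add: vec_eq_iff forall_2)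

lemma inner_vec2: "(v::real^2) \<bullet> w = v$1 * w$1 + v$2 * w$2"
  by (simp add: inner_vec_def sum_2)

lemma rotation_component [simp]:
  "rotation t v $ 1 = cos t * v$1 - sin t * v$2"
  "rotation t v $ 2 = sin t * v$1 + cos t * v$2"
  by (simp_all add: rotation_def)

lemma rotation_rotation: "rotation s (rotation t v) = rotation (s + t) v"
  by (simp add: vec2_eq_iff sin_add cos_add algebra_simps)

lemma rotation_0 [simp]: "rotation 0 v = v"
  by (simp add: vec2_eq_iff)

lemma linear_rotation: "linear (rotation t)"
  by (rule linearI) (simp_all add: vec2_eq_iff algebra_simps)

lemma rotation_scaleR [simp]: "rotation t (r *\<^sub>R v) = r *\<^sub>R rotation t v"
  by (rule linear_scale[OF linear_rotation])

lemma inner_rotation: "rotation t v \<bullet> rotation t w = v \<bullet> w"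
proof -
  have "rotation t v \<bullet> rotation t w = ((sin t)\<^sup>2 + (cos t)\<^sup>2) * (v$1 * w$1 + v$2 * w$2)"
    unfolding inner_vec2 rotation_component by algebra
  then show ?thesis by (simp add: inner_vec2)
qed

lemma inner_rotation_left: "rotation t v \<bullet> w = v \<bullet> rotation (- t) w"
  by (simp add: inner_vec2 algebra_simps)

lemma norm_rotation [simp]: "norm (rotation t v) = norm v"
  by (simp add: norm_eq_sqrt_inner inner_rotation)

lemma orthogonal_transformation_rotation: "orthogonal_transformation (rotation t)"
  by (simp add: orthogonal_transformation_def linear_rotation inner_rotation)

lemma rotation_2pi: "rotation (2 * pi) v = v"
  by (simp add: vec2_eq_iff)

lemma det2_rotation_self: "det2 (rotation s v) (rotation t v) = sin (t - s) * (norm v)\<^sup>2"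
  by (simp add: det2_def sin_diff power2_norm_eq_inner inner_vec2 algebra_simps)

lemma det2_simps [simp]:
  "det2 v v = 0" "det2 (r *\<^sub>R v) w = r * det2 v w" "det2 v (r *\<^sub>R w) = r * det2 v w"
  "det2 (v + v') w = det2 v w + det2 v' w" "det2 v (w + w') = det2 v w + det2 v w'"
  "det2 0 v = 0" "det2 v 0 = 0"
  by (simp_all add: det2_def algebra_simps)

lemma det2_commute: "det2 v w = - det2 w v"
  by (simp add: det2_def)

lemma invariant_rotation_iterate:
  assumes "rotation \<theta> ` K = K" "v \<in> K"
  shows "rotation (real k * \<theta>) v \<in> K"
proof (induction k)
  case (Suc k)
  have "rotation (real (Suc k) * \<theta>) v = rotation \<theta> (rotation (real k * \<theta>) v)"
    by (simp add: rotation_rotation algebra_simps)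
  then show ?case using Suc assms by (metis imageI)
qed (use assms in simp)

lemma invariant_rotation_uminus:
  assumes "rotation \<theta> ` K = K"
  shows "rotation (- \<theta>) ` K = K"
proof -
  have "rotation (- \<theta>) ` rotation \<theta> ` K = K"
    by (simp add: image_image rotation_rotation)
  then show ?thesis using assms by simp
qed

lemma polar_coordinates:
  assumes "v0 \<noteq> 0" "v \<noteq> 0"
  obtains r t where "r > 0" "0 \<le> t" "t < 2 * pi" "v = r *\<^sub>R rotation t v0"
proof -
  define r where "r = norm v / norm v0"
  define x where "x = (v \<bullet> v0) / (norm v * norm v0)"
  define y where "y = det2 v0 v / (norm v * norm v0)"
  have pos: "norm v * norm v0 > 0" using assms by simp
  have "(v \<bullet> v0)\<^sup>2 + (det2 v0 v)\<^sup>2 = (norm v)\<^sup>2 * (norm v0)\<^sup>2"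
    unfolding power2_norm_eq_inner inner_vec2 det2_def by algebra
  then have "x\<^sup>2 + y\<^sup>2 = 1"
    using pos assms by (simp add: x_def y_def power_divide power_mult_distrib flip: add_divide_distrib)
  then obtain t where t: "0 \<le> t" "t < 2*pi" "x = cos t" "y = sin t"
    using sincos_total_2pi by blast
  have r0: "r * x = (v \<bullet> v0) / (norm v0)\<^sup>2" "r * y = det2 v0 v / (norm v0)\<^sup>2"
    using assms by (simp_all add: r_def x_def y_def power2_eq_square)
  have nz: "(norm v0)\<^sup>2 \<noteq> 0" using assms by simp
  have "v $ 1 = (r * x) * v0$1 - (r * y) * v0$2" "v $ 2 = (r * y) * v0$1 + (r * x) * v0$2"
    unfolding r0 using nz
    by (simp_all add: field_simps) 
      (simp_all add: inner_vec2 det2_def power2_norm_eq_inner algebra_simps)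
  then have "v = r *\<^sub>R rotation t v0"
    by (simp add: vec2_eq_iff flip: t, simp add: algebra_simps)
  moreover have "r > 0" using assms by (simp add: r_def)
  ultimately show ?thesis using t that by blast
qed

lemma rotation_inject:
  assumes "rotation s v = rotation t v" "v \<noteq> 0" "\<bar>s - t\<bar> < 2 * pi"
  shows "s = t"
proof -
  have "rotation (s - t) v = v"
    using assms(1) by (metis add.commute diff_conv_add_uminus add.right_inverse rotation_0 rotation_rotation)
  then have "rotation (s - t) v \<bullet> v = v \<bullet> v" by simp
  moreover have "rotation (s - t) v \<bullet> v = cos (s - t) * (v \<bullet> v)"
    by (simp add: inner_vec2 algebra_simps)
  ultimately have "cos (s - t) = 1" using assms(2) by simp
  then obtain k :: int where k: "s - t = of_int k * 2 * pi"
    using cos_one_2pi_int by blast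
  have "\<bar>real_of_int k\<bar> * (2 * pi) < 1 * (2 * pi)"
    using assms(3) unfolding k by (simp add: abs_mult)
  then have "\<bar>real_of_int k\<bar> < 1" using mult_less_cancel_right_pos by (metis pi_gt_zero zero_less_mult_iff zero_less_numeral)
  then have "k = 0" by linarith
  then show ?thesis using k by simp
qed

section \<open>Area of rotation invariant sets\<close>

text \<open>
  The interior of the triangle with vertices \<open>0\<close>, \<open>v\<close>, \<open>w\<close> if these are in counterclockwise order.
  Otherwise the set is empty, so that degenerate triangles never meet their neighbours in a fan.
\<close>
definition open_triangle :: "real^2 \<Rightarrow> real^2 \<Rightarrow> (real^2) set" where
  "open_triangle v w = {p *\<^sub>R v + q *\<^sub>R w | p q. 0 < p \<and> 0 < q \<and> p + q < 1 \<and> 0 < det2 v w}"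

lemma open_triangle_measure:
  assumes "0 \<le> det2 v w"
  shows "open_triangle v w \<in> lmeasurable" "measure lebesgue (open_triangle v w) = det2 v w / 2"
proof -
  have "open_triangle v w \<in> lmeasurable \<and> measure lebesgue (open_triangle v w) = det2 v w / 2"
  proof (cases "det2 v w = 0")
    case True
    then show ?thesis by (simp add: open_triangle_def)
  next
    case False
    with assms have pos: "0 < det2 v w" by simp
    have "\<not> collinear {0, v, w}"
    proof
      assume "collinear {0, v, w}"
      then have "v = 0 \<or> w = 0 \<or> (\<exists>c. w = c *\<^sub>R v)" by (simp add: collinear_lemma)
      then have "det2 v w = 0" by auto
      then show False using False by simp
    qed
    then have "interior (convex hull {0, v, w}) =
        {u. \<exists>x y z. 0 < x \<and> 0 < y \<and> 0 < z \<and> x + y + z = 1 \<and> x *\<^sub>R 0 + y *\<^sub>R v + z *\<^sub>R w = u}"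
      by (intro interior_convex_hull_3_minimal) auto
    also have "\<dots> = open_triangle v w"
    proof (intro set_eqI iffI)
      fix u assume "u \<in> open_triangle v w"
      then obtain p q where "0 < p" "0 < q" "p + q < 1" "u = p *\<^sub>R v + q *\<^sub>R w"
        by (auto simp: open_triangle_def)
      then have "0 < 1 - p - q \<and> 0 < p \<and> 0 < q \<and> (1 - p - q) + p + q = 1 \<and>
          (1 - p - q) *\<^sub>R 0 + p *\<^sub>R v + q *\<^sub>R w = u" by simp
      then show "u \<in> {u. \<exists>x y z. 0 < x \<and> 0 < y \<and> 0 < z \<and> x + y + z = 1 \<and> x *\<^sub>R 0 + y *\<^sub>R v + z *\<^sub>R w = u}"
        by blast
    qed (use pos in \<open>force simp: open_triangle_def\<close>)
    finally have int: "interior (convex hull {0, v, w}) = open_triangle v w" .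
    have bd: "bounded (convex hull {0, v, w})" by (simp add: bounded_convex_hull)
    have "measure lebesgue (open_triangle v w) = measure lebesgue (convex hull {0, v, w})"
      unfolding int[symmetric] using bd by (intro measure_interior negligible_convex_frontier) auto
    also have "\<dots> = measure lborel (convex hull {0, v, w})"
      by (intro measure_completion) (simp add: borel_compact compact_convex_hull)
    also have "\<dots> = det2 v w / 2"
      unfolding content_triangle using pos by (simp add: det2_def abs_if algebra_simps)
    finally show ?thesis using int bd lmeasurable_interior by metis
  qed
  then show "open_triangle v w \<in> lmeasurable" "measure lebesgue (open_triangle v w) = det2 v w / 2"
    by auto
qed

lemma open_triangle_subset:
  assumes "convex S" "0 \<in> S" "v \<in> S" "w \<in> S"
  shows "open_triangle v w \<subseteq> S"
proof
  fix u assume "u \<in> open_triangle v w"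
  then obtain p q where pq: "0 < p" "0 < q" "p + q < 1" "u = p *\<^sub>R v + q *\<^sub>R w"
    by (auto simp: open_triangle_def)
  have "u = (p + q) *\<^sub>R ((p / (p + q)) *\<^sub>R v + (q / (p + q)) *\<^sub>R w) + (1 - (p + q)) *\<^sub>R 0"
    using pq by (simp add: scaleR_add_right)
  also have "\<dots> \<in> S"
    using pq assms by (intro convexD[OF assms(1)]) (auto simp flip: add_divide_distrib)
  finally show "u \<in> S" .
qed

text \<open>
  For \<open>0 < \<theta> < pi\<close> the open angular region swept out when the ray through \<open>v\<close> turns by \<open>\<theta>\<close>.
\<close>
definition open_sector :: "real \<Rightarrow> real^2 \<Rightarrow> (real^2) set" where
  "open_sector \<theta> v = {u. 0 < det2 v u \<and> 0 < det2 u (rotation \<theta> v)}"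

lemma open_sector_polar:
  assumes "v \<noteq> 0" "0 < \<theta>" "\<theta> < pi" "u \<in> open_sector \<theta> v"
  obtains r t where "0 < r" "0 < t" "t < \<theta>" "u = r *\<^sub>R rotation t v"
proof -
  have "u \<noteq> 0" using assms(4) by (auto simp: open_sector_def)
  then obtain r t where rt: "r > 0" "0 \<le> t" "t < 2 * pi" "u = r *\<^sub>R rotation t v"
    using polar_coordinates assms(1) by metis
  have nv: "0 < (norm v)\<^sup>2" using assms(1) by simp
  have "det2 v u = r * (sin t * (norm v)\<^sup>2)"
    using det2_rotation_self[of 0 v t] rt by simp
  then have s1: "sin t > 0"
    using assms(4) rt(1) nv by (simp add: open_sector_def zero_less_mult_iff)
  have "det2 u (rotation \<theta> v) = r * (sin (\<theta> - t) * (norm v)\<^sup>2)"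
    using det2_rotation_self[of t v \<theta>] rt by simp
  then have s2: "sin (\<theta> - t) > 0"
    using assms(4) rt(1) nv by (simp add: open_sector_def zero_less_mult_iff)
  have "t \<noteq> 0" using s1 by auto
  have "t < pi" using s1 rt(3) sin_le_zero[of t] by fastforce
  moreover have "t < \<theta>"
  proof (rule ccontr)
    assume "\<not> t < \<theta>"
    then have "sin (t - \<theta>) \<ge> 0" using \<open>t < pi\<close> assms(2) by (intro sin_ge_zero) auto
    then show False using s2 sin_minus[of "t - \<theta>"] by simp
  qed
  ultimately show ?thesis using that[of r t] rt \<open>t \<noteq> 0\<close> by simp
qed

text \<open>
  The \<open>n\<close> images of a sector of angle \<open>2 * pi / n\<close> are pairwise disjoint, so each part of the
  invariant set inside one sector counts \<open>n\<close> times.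
\<close>
lemma rotated_sectors_area:
  assumes n: "n \<ge> 3" and \<theta>: "\<theta> = 2 * pi / real n"
    and S: "S \<in> lmeasurable" "rotation \<theta> ` S = S"
    and T: "T \<in> lmeasurable" "T \<subseteq> S" "T \<subseteq> open_sector \<theta> v" and "v \<noteq> 0"
  shows "real n * measure lebesgue T \<le> measure lebesgue S"
proof -
  have \<theta>0: "0 < \<theta>" using n by (simp add: \<theta>)
  have \<theta>pi: "\<theta> < pi" using n by (simp add: \<theta> field_simps)
  let ?F = "\<lambda>k. rotation (real k * \<theta>) ` T"
  have meas: "?F k \<in> lmeasurable" "measure lebesgue (?F k) = measure lebesgue T" for k
    by (intro measurable_orthogonal_image measure_orthogonal_image orthogonal_transformation_rotation T(1))+
  have disj: "disjnt (?F i) (?F j)" if ij: "i < n" "j < n" "i \<noteq> j" for i j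
  proof (rule ccontr)
    assume "\<not> disjnt (?F i) (?F j)"
    then obtain x y where xy: "x \<in> T" "y \<in> T" "rotation (real i * \<theta>) x = rotation (real j * \<theta>) y"
      by (force simp: disjnt_def)
    obtain r t where rt: "0 < r" "0 < t" "t < \<theta>" "x = r *\<^sub>R rotation t v"
      using open_sector_polar[of v \<theta> x] \<theta>0 \<theta>pi T(3) xy assms(8) by blast
    obtain r' t' where rt': "0 < r'" "0 < t'" "t' < \<theta>" "y = r' *\<^sub>R rotation t' v"
      using open_sector_polar[of v \<theta> y] \<theta>0 \<theta>pi T(3) xy assms(8) by blast
    have eq: "r *\<^sub>R rotation (real i * \<theta> + t) v = r' *\<^sub>R rotation (real j * \<theta> + t') v"
      using xy(3) rt rt' by (simp add: rotation_rotation)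
    then have "r * norm v = r' * norm v"
      using rt(1) rt'(1) by (metis abs_of_pos norm_rotation norm_scaleR)
    then have "r = r'" using assms(8) by simp
    with eq have eq2: "rotation (real i * \<theta> + t) v = rotation (real j * \<theta> + t') v"
      using rt by simp
    have n\<theta>: "real n * \<theta> = 2 * pi" using n by (simp add: \<theta>)
    have "0 < real i * \<theta> + t \<and> real i * \<theta> + t < 2 * pi" if "i < n" "0 < t" "t < \<theta>" for i t
    proof -
      have "real i * \<theta> + t < (real i + 1) * \<theta>" using that by (simp add: algebra_simps)
      also have "\<dots> \<le> real n * \<theta>" using that \<theta>0 by (intro mult_right_mono) auto
      finally show ?thesis using n\<theta> \<theta>0 that by (simp add: add_nonneg_pos)
    qed
    from this[OF ij(1) rt(2,3)] this[OF ij(2) rt'(2,3)]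
    have "real i * \<theta> + t = real j * \<theta> + t'"
      by (intro rotation_inject[OF eq2 assms(8)]) linarith
    then have "(real i - real j) * \<theta> = t' - t" by (simp add: algebra_simps)
    then have "\<bar>(real i - real j) * \<theta>\<bar> < 1 * \<theta>"
      using rt rt' by simp
    then have "\<bar>real i - real j\<bar> < 1" using \<theta>0 by (simp add: abs_mult)
    then show False using ij(3) by linarith
  qed
  have "measure lebesgue (\<Union>k<n. ?F k) = (\<Sum>k<n. measure lebesgue (?F k))"
    using meas disj by (intro measure_UNION') (auto simp: pairwise_def)
  also have "\<dots> = real n * measure lebesgue T" using meas by simp
  finally have "real n * measure lebesgue T = measure lebesgue (\<Union>k<n. ?F k)" by simp
  also have "\<dots> \<le> measure lebesgue S"
  proof (rule measure_mono_fmeasurable)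
    show "(\<Union>k<n. ?F k) \<subseteq> S"
      using invariant_rotation_iterate[OF S(2)] T(2) by auto
    show "(\<Union>k<n. ?F k) \<in> sets lebesgue" using meas by (intro sets.finite_UN) auto
  qed (use S in auto)
  finally show ?thesis .
qed

text \<open>
  The triangles of the fan lie in one sector and are separated by the rays through \<open>v1\<close> and \<open>v2\<close>.
  This single estimate bounds the area of the body and of its polar from below.
\<close>
lemma fan_area:
  assumes n: "n \<ge> 3" and \<theta>: "\<theta> = 2 * pi / real n"
    and S: "S \<in> lmeasurable" "rotation \<theta> ` S = S" "convex S" "0 \<in> S"
    and v: "v0 \<in> S" "v1 \<in> S" "v2 \<in> S" "v0 \<noteq> 0" "v3 = rotation \<theta> v0"
    and d: "det2 v0 v1 \<ge> 0" "det2 v0 v2 \<ge> 0" "det2 v1 v2 \<ge> 0" "det2 v1 v3 \<ge> 0" "det2 v2 v3 \<ge> 0"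
  shows "real n * ((det2 v0 v1 + det2 v1 v2 + det2 v2 v3) / 2) \<le> measure lebesgue S"
proof -
  have \<theta>0: "0 < \<theta>" and \<theta>pi: "\<theta> < pi" using n by (simp_all add: \<theta> field_simps)
  have v3: "v3 \<in> S" using v S(2) by blast
  have d03: "det2 v0 v3 > 0"
    using det2_rotation_self[of 0 v0 \<theta>] v(4,5) sin_gt_zero[OF \<theta>0 \<theta>pi] by simp
  define T1 where "T1 = open_triangle v0 v1"
  define T2 where "T2 = open_triangle v1 v2"
  define T3 where "T3 = open_triangle v2 v3"
  have nz: "v0 \<noteq> 0" "v3 \<noteq> 0" using d03 by auto
  have plane: "det2 u w *\<^sub>R z = det2 z w *\<^sub>R u + det2 u z *\<^sub>R w" for u w z
    by (simp add: vec2_eq_iff det2_def algebra_simps)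
  have anti: "det2 v1 v0 = - det2 v0 v1" "det2 v2 v0 = - det2 v0 v2" "det2 v2 v1 = - det2 v1 v2"
    using det2_commute by blast+
  \<comment> \<open>The middle triangle may share a boundary ray of the sector with one of its vertices, but not
    with both: two vertices on the same ray span a degenerate triangle.\<close>
  have d12: "0 < det2 v0 v1 \<or> 0 < det2 v0 v2" "0 < det2 v1 v3 \<or> 0 < det2 v2 v3" if "0 < det2 v1 v2"
  proof -
    show "0 < det2 v0 v1 \<or> 0 < det2 v0 v2"
    proof (rule ccontr)
      assume "\<not> ?thesis"
      then have "det2 v0 v2 = 0" "det2 v1 v0 = 0" using d anti by auto
      then have "det2 v1 v2 *\<^sub>R v0 = 0" by (subst plane) simp
      then show False using that nz by simp
    qed
    show "0 < det2 v1 v3 \<or> 0 < det2 v2 v3"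
    proof (rule ccontr)
      assume "\<not> ?thesis"
      then have "det2 v3 v2 = 0" "det2 v1 v3 = 0" using d det2_commute[of v3 v2] by auto
      then have "det2 v1 v2 *\<^sub>R v3 = 0" by (subst plane) simp
      then show False using that nz by simp
    qed
  qed
  have "T1 \<subseteq> open_sector \<theta> v0"
    using d d03 by (auto simp: T1_def open_triangle_def open_sector_def simp flip: v(5) intro!: add_pos_nonneg)
  moreover have "T2 \<subseteq> open_sector \<theta> v0"
  proof
    fix x assume "x \<in> T2"
    then obtain p q where x: "x = p *\<^sub>R v1 + q *\<^sub>R v2" "0 < p" "0 < q" "0 < det2 v1 v2"
      by (auto simp: T2_def open_triangle_def)
    have "0 < p * A + q * B" if "0 \<le> A" "0 \<le> B" "0 < A \<or> 0 < B" for A B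
      using that x by (auto intro: add_pos_nonneg add_nonneg_pos)
    then show "x \<in> open_sector \<theta> v0"
      using d d12[OF x(4)] x(1) by (simp add: open_sector_def flip: v(5))
  qed
  moreover have "T3 \<subseteq> open_sector \<theta> v0"
    using d d03 by (auto simp: T3_def open_triangle_def open_sector_def simp flip: v(5) intro!: add_nonneg_pos)
  ultimately have sub: "T1 \<union> T2 \<union> T3 \<subseteq> open_sector \<theta> v0" by blast
  have meas: "T1 \<in> lmeasurable" "T2 \<in> lmeasurable" "T3 \<in> lmeasurable"
    using open_triangle_measure d by (auto simp: T1_def T2_def T3_def)
  have a: "det2 v1 x < 0" if "x \<in> T1" for x
    using that by (auto simp: T1_def open_triangle_def anti)
  have b: "det2 v1 x > 0" if "x \<in> T2" for x
    using that by (auto simp: T2_def open_triangle_def anti)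
  have c: "det2 v2 x < 0" if "x \<in> T2" for x
    using that by (auto simp: T2_def open_triangle_def anti)
  have e: "det2 v2 x > 0" if "x \<in> T3" for x
    using that by (auto simp: T3_def open_triangle_def anti)
  have f: "det2 v2 x \<le> 0" if x: "x \<in> T1" for x
  proof -
    obtain p q where pq: "x = p *\<^sub>R v0 + q *\<^sub>R v1" "0 < p" "0 < q"
      using x by (auto simp: T1_def open_triangle_def)
    then have "0 \<le> p * det2 v0 v2 + q * det2 v1 v2" using d by simp
    then show ?thesis using pq(1) by (simp add: anti)
  qed
  have "False" if "x \<in> T1" "x \<in> T2" for x using a[OF that(1)] b[OF that(2)] by simp
  moreover have "False" if "x \<in> T1" "x \<in> T3" for x using f[OF that(1)] e[OF that(2)] by simp
  moreover have "False" if "x \<in> T2" "x \<in> T3" for x using c[OF that(1)] e[OF that(2)] by simp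
  ultimately have disj: "T1 \<inter> T2 = {}" "(T1 \<union> T2) \<inter> T3 = {}" by blast+
  have "measure lebesgue (T1 \<union> T2 \<union> T3) = measure lebesgue (T1 \<union> T2) + measure lebesgue T3"
    using meas disj(2) by (simp add: measure_Un3 fmeasurable.Un)
  moreover have "measure lebesgue (T1 \<union> T2) = measure lebesgue T1 + measure lebesgue T2"
    using meas disj(1) by (simp add: measure_Un3)
  moreover have "measure lebesgue T1 + measure lebesgue T2 + measure lebesgue T3
      = (det2 v0 v1 + det2 v1 v2 + det2 v2 v3) / 2"
    using open_triangle_measure(2) d unfolding T1_def T2_def T3_def by simp
  ultimately have "measure lebesgue (T1 \<union> T2 \<union> T3) = (det2 v0 v1 + det2 v1 v2 + det2 v2 v3) / 2"
    by simp
  moreover have "real n * measure lebesgue (T1 \<union> T2 \<union> T3) \<le> measure lebesgue S"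
    using meas sub open_triangle_subset[OF S(3,4)] v v3 T1_def T2_def T3_def
    by (intro rotated_sectors_area[OF n \<theta> S(1,2)]) (auto intro: fmeasurable.Un)
  ultimately show ?thesis by metis
qed

section \<open>Polar bodies\<close>

lemma polar_convex: "convex (polar K)"
proof (rule convexI)
  fix x y :: "real^2" and u v :: real
  assume xy: "x \<in> polar K" "y \<in> polar K" and uv: "0 \<le> u" "0 \<le> v" "u + v = 1"
  show "u *\<^sub>R x + v *\<^sub>R y \<in> polar K"
    unfolding polar_def
  proof (intro CollectI ballI)
    fix z assume "z \<in> K"
    then have "x \<bullet> z \<le> 1" "y \<bullet> z \<le> 1" using xy by (auto simp: polar_def)
    then have "u * (x \<bullet> z) + v * (y \<bullet> z) \<le> u * 1 + v * 1"
      using uv by (intro add_mono mult_left_mono)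
    then show "(u *\<^sub>R x + v *\<^sub>R y) \<bullet> z \<le> 1" using uv by (simp add: inner_add_left)
  qed
qed

lemma polar_closed: "closed (polar K)"
proof -
  have "polar K = (\<Inter>y\<in>K. {x. y \<bullet> x \<le> 1})" by (auto simp: polar_def inner_commute)
  then show ?thesis by (simp add: closed_INT closed_halfspace_le)
qed

lemma polar_bounded:
  assumes "0 \<in> interior K"
  shows "bounded (polar K)"
proof -
  obtain e where e: "e > 0" "cball 0 e \<subseteq> K"
    using assms mem_interior_cball by blast
  have "norm x \<le> 1 / e" if "x \<in> polar K" for x
  proof (cases "x = 0")
    case False
    have "(e / norm x) *\<^sub>R x \<in> K" using e False by (intro set_mp[OF e(2)]) simp
    then have "x \<bullet> ((e / norm x) *\<^sub>R x) \<le> 1" using that by (auto simp: polar_def)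
    then have "e * norm x \<le> 1" using False by (simp add: dot_square_norm power2_eq_square)
    then show ?thesis using e by (simp add: field_simps)
  qed (use e in simp)
  then show ?thesis by (auto simp: bounded_iff)
qed

lemma polar_compact: "0 \<in> interior K \<Longrightarrow> compact (polar K)"
  by (simp add: compact_eq_bounded_closed polar_bounded polar_closed)

lemma polar_rotation:
  assumes "rotation \<theta> ` K = K"
  shows "rotation \<theta> ` polar K = polar K"
proof -
  have sub: "rotation t ` polar K \<subseteq> polar K" if "rotation (- t) ` K = K" for t
    using that by (force simp: polar_def inner_rotation_left)
  have "rotation (- \<theta>) ` polar K \<subseteq> polar K" using sub[of "- \<theta>"] assms by simp
  then have "rotation \<theta> ` rotation (- \<theta>) ` polar K \<subseteq> rotation \<theta> ` polar K" by blast
  then have "polar K \<subseteq> rotation \<theta> ` polar K" by (simp add: image_image rotation_rotation)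
  with sub[OF invariant_rotation_uminus[OF assms]] show ?thesis by blast
qed

lemma interior_orthogonal_image:
  fixes T :: "real^2 \<Rightarrow> real^2"
  assumes "orthogonal_transformation T"
  shows "interior (T ` S) = T ` interior S"
  using assms by (intro interior_injective_linear_image)
    (auto simp: orthogonal_transformation_linear orthogonal_transformation_inj)

lemma polar_orthogonal_image:
  fixes T :: "real^2 \<Rightarrow> real^2"
  assumes T: "orthogonal_transformation T"
  shows "polar (T ` K) = T ` polar K"
proof -
  have inner: "T v \<bullet> T w = v \<bullet> w" for v w using T by (simp add: orthogonal_transformation_def)
  show ?thesis
  proof (intro set_eqI iffI)
    fix y assume y: "y \<in> polar (T ` K)"
    obtain z where z: "y = T z" using orthogonal_transformation_surj[OF T] by (metis surjD)
    then have "z \<in> polar K" using y inner by (auto simp: polar_def)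
    then show "y \<in> T ` polar K" using z by blast
  qed (auto simp: polar_def inner)
qed

lemma area_orthogonal_image:
  fixes T :: "real^2 \<Rightarrow> real^2"
  assumes "orthogonal_transformation T" "compact S"
  shows "area (T ` S) = area S"
  unfolding area_def using assms by (intro measure_orthogonal_image lmeasurable_compact)

lemma scale_area:
  fixes S :: "(real^2) set"
  assumes "compact S"
  shows "area ((*\<^sub>R) r ` S) = r\<^sup>2 * area S"
proof -
  have ax: "axis (1::2) (1::real) $ 1 = 1" "axis (1::2) (1::real) $ 2 = 0"
      "axis (2::2) (1::real) $ 1 = 0" "axis (2::2) (1::real) $ 2 = 1"
      by (simp_all add: axis_def)
  have "det (matrix ((*\<^sub>R) r :: real^2 \<Rightarrow> real^2)) = r\<^sup>2"
    by (simp add: det_2 matrix_def ax power2_eq_square)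
  then show ?thesis
    unfolding area_def using measure_linear_image[of "(*\<^sub>R) r" S] assms
    by (simp add: lmeasurable_compact linear_scale_self linear_scaleR)
qed

lemma scale_polar:
  assumes "r > 0"
  shows "polar ((*\<^sub>R) r ` S) = (*\<^sub>R) (1 / r) ` polar S"
proof (intro set_eqI iffI)
  fix x assume "x \<in> polar ((*\<^sub>R) r ` S)"
  then have "r *\<^sub>R x \<in> polar S" by (simp add: polar_def)
  then show "x \<in> (*\<^sub>R) (1 / r) ` polar S" using assms by (intro image_eqI[of _ _ "r *\<^sub>R x"]) auto
qed (use assms in \<open>auto simp: polar_def\<close>)

lemma scale_area_product:
  fixes S :: "(real^2) set"
  assumes "r > 0" "compact S" "0 \<in> interior S"
  shows "area ((*\<^sub>R) r ` S) * area (polar ((*\<^sub>R) r ` S)) = area S * area (polar S)"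
  using assms by (simp add: scale_polar scale_area polar_compact power_divide)

section \<open>The area product of two polar sectors\<close>

text \<open>
  The two factors are twice the fan areas: \<open>s * h - c * \<alpha>\<close> is the triangle over \<open>a = (s, c)\<close> and
  \<open>x = (\<alpha>, h)\<close>, and \<open>m\<close> is the pair of triangles over \<open>x\<close>, \<open>z\<close> and \<open>b = (- s, c)\<close>, which is least, equal
  to \<open>m0 = \<alpha> * c + s * h\<close>, when \<open>z\<close> lies on the chord from \<open>x\<close> to \<open>b\<close>.  The numerator over \<open>m\<close> equals
  \<open>m0 * (s / h) + A * (B + s * \<alpha>)\<close> with \<open>A = 1 - c / h\<close> and \<open>B = 1 - c * h\<close>.  The first summand alone
  gives \<open>4 * s\<^sup>2\<close>, because \<open>m0 \<ge> s * h\<close> makes the gain in the first factor outweigh the loss in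
  the second as \<open>m\<close> grows; the other summand gives the surplus \<open>A * B\<close>.  For \<open>\<alpha> < 0\<close> the
  inequality \<open>m0 \<ge> s * h\<close> can fail; the body is reflected in that case.
\<close>
lemma sector_product_bound:
  fixes s c \<alpha> h m :: real
  assumes sc: "0 < s" "s\<^sup>2 + c\<^sup>2 = 1" and h: "0 < h" "c \<le> h"
    and \<alpha>: "0 \<le> \<alpha>" "0 \<le> c" "c * \<alpha> \<le> s * h" "\<alpha> * s + c * h \<le> 1" and m: "\<alpha> * c + s * h \<le> m"
  shows "4 * s\<^sup>2 + (1 - c / h) * (1 - c * h)
    \<le> (s * h - c * \<alpha> + m) * (s / h + ((h - c) / h + s * (\<alpha> + s) - c * (h - c)) / m)"
proof -
  define A where "A = 1 - c / h"
  define B where "B = 1 - c * h"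
  define m0 where "m0 = \<alpha> * c + s * h"
  define D where "D = (m - m0) / 2"
  have A0: "0 \<le> A" using h by (simp add: A_def)
  have B0: "0 \<le> B" using \<alpha>(1,4) sc by (smt (verit) B_def mult_nonneg_nonneg)
  have D0: "0 \<le> D" using m by (simp add: D_def m0_def)
  have m0: "s * h \<le> m0" "m0 \<le> 2 * (s * h)" "m = m0 + 2 * D"
    using \<alpha> by (simp_all add: m0_def algebra_simps) (simp add: D_def m0_def field_simps)
  have sh: "0 < s * h" using sc h by simp
  have mpos: "0 < m" using m0 sh D0 by linarith
  have q: "(h - c) / h + s * (\<alpha> + s) - c * (h - c) = m0 * (s / h) + A * (B + s * \<alpha>)"
  proof -
    have "c\<^sup>2 = 1 - s\<^sup>2" using sc by simp
    have "h * ((h - c) / h + s * (\<alpha> + s) - c * (h - c)) = h * (m0 * (s / h) + A * (B + s * \<alpha>))"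
      using h \<open>c\<^sup>2 = 1 - s\<^sup>2\<close> unfolding A_def B_def m0_def
      by (simp add: field_simps power2_eq_square)
    then show ?thesis using h by simp
  qed
  have e1: "s * h - c * \<alpha> + m = 2 * (s * h + D)"
    by (simp add: m0(3) m0_def algebra_simps)
  have "(4 * s\<^sup>2 + A * B) * m \<le> 2 * (s * h + D) * (s / h * m + (m0 * (s / h) + A * (B + s * \<alpha>)))"
  proof -
    have "(s * h) * D \<le> m0 * D" using m0(1) D0 by (rule mult_right_mono)
    moreover have "(s * h + D) * (m0 + D) = (s * h) * m0 + (s * h) * D + m0 * D + D * D"
      "(s * h) * (m0 + 2 * D) = (s * h) * m0 + (s * h) * D + (s * h) * D"
      by (simp_all add: algebra_simps)
    ultimately have "(s * h) * (m0 + 2 * D) \<le> (s * h + D) * (m0 + D)"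
      using zero_le_square[of D] by linarith
    then have "(4 * (s / h)) * ((s * h) * m) \<le> (4 * (s / h)) * ((s * h + D) * (m0 + D))"
      unfolding m0(3) using sc h by (intro mult_left_mono) auto
    moreover have "(4 * (s / h)) * ((s * h) * m) = 4 * s\<^sup>2 * m"
      using h by (simp add: power2_eq_square)
    moreover have "A * B * m \<le> A * B * (2 * (s * h + D))"
      using A0 B0 m0 by (intro mult_left_mono) auto
    moreover have "A * B * (2 * (s * h + D)) \<le> A * (B + s * \<alpha>) * (2 * (s * h + D))"
      using A0 sc \<alpha> sh D0 by (intro mult_right_mono mult_left_mono) auto
    moreover have "2 * (s * h + D) * (s / h * m + (m0 * (s / h) + A * (B + s * \<alpha>)))
        = (4 * (s / h)) * ((s * h + D) * (m0 + D)) + A * (B + s * \<alpha>) * (2 * (s * h + D))"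
      unfolding m0(3) by (simp add: algebra_simps)
    moreover have "(4 * s\<^sup>2 + A * B) * m = 4 * s\<^sup>2 * m + A * B * m" by (simp add: algebra_simps)
    ultimately show ?thesis by linarith
  qed
  then have "4 * s\<^sup>2 + A * B \<le> 2 * (s * h + D) * (s / h * m + (m0 * (s / h) + A * (B + s * \<alpha>))) / m"
    using mpos by (simp add: pos_le_divide_eq)
  also have "\<dots> = 2 * (s * h + D) * (s / h + (m0 * (s / h) + A * (B + s * \<alpha>)) / m)"
    using mpos by (simp add: add_divide_distrib distrib_left)
  finally show ?thesis unfolding e1 q A_def B_def .
qed

text \<open>
  The linear functional is \<open>z \<mapsto> det2 x z + det2 z b\<close>, twice the area of the fan over \<open>x\<close>, \<open>z\<close>, \<open>b\<close>.
  It is maximised over all of \<open>K\<close>, so that its normalised coefficient vector belongs to the polar.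
  A maximiser outside the cone of \<open>x\<close> and \<open>b\<close> can be replaced by \<open>x\<close> or by \<open>b\<close>: beyond \<open>x\<close>
  because \<open>x\<close> has the greatest second coordinate, beyond \<open>b\<close> because \<open>K\<close> lies inside the
  tangent to the unit circle at \<open>b\<close>, along which the functional does not increase.
\<close>
lemma highest_chord_point:
  fixes K :: "(real^2) set" and s c \<alpha> h :: real
  assumes K: "compact K" "K \<subseteq> cball 0 1"
    and sc: "0 < s" "0 < c" "s\<^sup>2 + c\<^sup>2 = 1"
    and x: "vector [\<alpha>, h] \<in> K" "0 \<le> \<alpha>" and h: "c \<le> h" "h \<le> 1" "\<And>v. v \<in> K \<Longrightarrow> v $ 2 \<le> h"
    and b: "vector [- s, c] \<in> K"
  obtains z where "z \<in> K" "0 \<le> det2 (vector [\<alpha>, h]) z" "0 \<le> det2 z (vector [- s, c])"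
    "\<And>v. v \<in> K \<Longrightarrow> v \<bullet> vector [- (h - c), \<alpha> + s] \<le> z \<bullet> vector [- (h - c), \<alpha> + s]"
proof -
  define x b N :: "real^2" where
    "x = vector [\<alpha>, h]" and "b = vector [- s, c]" and "N = vector [- (h - c), \<alpha> + s]"
  have "continuous_on K (\<lambda>v. v \<bullet> N)" by (intro continuous_intros)
  then obtain z where z: "z \<in> K" "\<And>v. v \<in> K \<Longrightarrow> v \<bullet> N \<le> z \<bullet> N"
    using continuous_attains_sup[OF K(1)] b by blast
  have xK: "x \<in> K" and bK: "b \<in> K" using assms by (simp_all add: x_def b_def)
  have dxb: "0 \<le> det2 x b" using sc x h by (simp add: x_def b_def det2_def)
  consider "0 \<le> det2 x z" "0 \<le> det2 z b" | "det2 x z < 0" | "det2 z b < 0" by linarith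
  then obtain y where "y \<in> K" "0 \<le> det2 x y" "0 \<le> det2 y b" "z \<bullet> N \<le> y \<bullet> N"
  proof cases
    case 1
    then show ?thesis using that z by blast
  next
    case 2
    have "h * (\<alpha> - z$1) \<le> \<alpha> * (h - z$2)" using 2 by (simp add: det2_def x_def algebra_simps)
    then have "(h - c) * (h * (\<alpha> - z$1)) \<le> (h - c) * (\<alpha> * (h - z$2))"
      using h by (intro mult_left_mono) auto
    also have "\<dots> \<le> h * ((\<alpha> + s) * (h - z$2))"
      using h(1) h(3)[OF z(1)] x(2) sc by (intro mult_mono) auto
    finally have "h * ((h - c) * (\<alpha> - z$1)) \<le> h * ((\<alpha> + s) * (h - z$2))" by (simp add: mult_ac)
    then have "(h - c) * (\<alpha> - z$1) \<le> (\<alpha> + s) * (h - z$2)" using h sc by simp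
    then have "z \<bullet> N \<le> x \<bullet> N" by (simp add: inner_vec2 N_def x_def algebra_simps)
    then show ?thesis using that[of x] xK dxb by simp
  next
    case 3
    define k where "k = z \<bullet> b"
    define l where "l = - det2 z b"
    have nb: "norm b = 1" using sc by (simp add: norm_eq_sqrt_inner inner_vec2 b_def power2_eq_square)
    have "norm z \<le> 1" using K z by auto
    then have "norm z * norm b \<le> 1" using nb by simp
    then have k: "k \<le> 1" unfolding k_def using norm_cauchy_schwarz order_trans by blast
    have l: "0 < l" using 3 by (simp add: l_def)
    have "z$1 = z$1 * (s\<^sup>2 + c\<^sup>2)" "z$2 = z$2 * (s\<^sup>2 + c\<^sup>2)" using sc by simp_all
    then have zz: "z$1 = - s * k - c * l" "z$2 = c * k - s * l"
      by (simp_all add: k_def l_def inner_vec2 det2_def b_def algebra_simps power2_eq_square)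
    have "(h - c) * c \<le> (1 - c) * (1 + c)" using h sc by (intro mult_mono) auto
    also have "\<dots> = s\<^sup>2" using sc by (simp add: algebra_simps power2_eq_square)
    also have "\<dots> \<le> s * (\<alpha> + s)" using sc x by (simp add: power2_eq_square)
    finally have "l * ((h - c) * c - s * (\<alpha> + s)) \<le> 0" using l by (simp add: mult_le_0_iff)
    moreover have "0 \<le> (1 - k) * ((\<alpha> + s) * c + (h - c) * s)" using k h sc x by simp
    moreover have "b \<bullet> N - z \<bullet> N = (1 - k) * ((\<alpha> + s) * c + (h - c) * s) - l * ((h - c) * c - s * (\<alpha> + s))"
      by (simp add: inner_vec2 N_def b_def zz algebra_simps)
    ultimately have "z \<bullet> N \<le> b \<bullet> N" by linarith
    then show ?thesis using that[of b] bK dxb by simp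
  qed
  then show ?thesis using that[of y] z(2) unfolding x_def b_def N_def by (meson order_trans)
qed

text \<open>
  Coordinates are chosen such that the first sector is symmetric about the second axis.  The body
  contains the fan over \<open>a\<close>, \<open>x\<close>, \<open>z\<close>, \<open>b\<close> and the polar the fan over \<open>a\<close>, \<open>(0, 1 / h)\<close>, \<open>u\<close>, \<open>b\<close>,
  where \<open>u\<close> is the normal \<open>N\<close> of the chord from \<open>x\<close> to \<open>b\<close> divided by its maximum on \<open>K\<close>.
\<close>
lemma area_product_bound_upright:
  fixes K :: "(real^2) set"
  assumes n: "n \<ge> 3" and \<theta>: "\<theta> = 2 * pi / real n" and sdef: "s = sin (pi / real n)" and cdef: "c = cos (pi / real n)"
    and K: "compact K" "convex K" "0 \<in> interior K" "rotation \<theta> ` K = K" "K \<subseteq> cball 0 1"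
    and a: "vector [s, c] \<in> K"
    and x: "vector [\<alpha>, h] \<in> K" "0 \<le> \<alpha>" "\<And>v. v \<in> K \<Longrightarrow> v $ 2 \<le> h"
  shows "(real n)\<^sup>2 * (s\<^sup>2 + (1 - c / h) * (1 - c * h) / 4) \<le> area K * area (polar K)"
proof -
  define av xv bv N :: "real^2" where
    "av = vector [s, c]" and "xv = vector [\<alpha>, h]" and "bv = vector [- s, c]"
    and "N = vector [- (h - c), \<alpha> + s]"
  have \<tau>: "0 < pi / real n" "pi / real n < pi / 2" using n by (simp_all add: field_simps)
  have s0: "0 < s" using \<tau> unfolding sdef by (intro sin_gt_zero) linarith+
  have c0: "0 < c" using \<tau> unfolding cdef by (intro cos_gt_zero_pi) linarith+
  have sc: "s\<^sup>2 + c\<^sup>2 = 1" by (simp add: sdef cdef)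
  have \<theta>2: "\<theta> = 2 * (pi / real n)" by (simp add: \<theta>)
  have b: "bv = rotation \<theta> av"
    unfolding vec2_eq_iff \<theta>2 av_def bv_def rotation_component vector_2
      sin_double[of "pi / real n"] cos_double[of "pi / real n"] sdef[symmetric] cdef[symmetric]
    using sc by (simp add: power2_eq_square algebra_simps) (algebra)
  have bK: "bv \<in> K" using b a K(4) by (auto simp: av_def)
  have h0: "c \<le> h" using x(3)[OF a] by simp
  have "norm xv \<le> 1" using x K(5) by (auto simp: xv_def)
  then have "xv \<bullet> xv \<le> 1" by (simp add: norm_le_square dot_square_norm power_le_one)
  then have ah: "\<alpha>\<^sup>2 + h\<^sup>2 \<le> 1" by (simp add: xv_def inner_vec2 power2_eq_square)
  have h1: "h \<le> 1"
    using ah by (smt (verit) one_le_power power2_eq_square mult_less_cancel_left2 zero_le_power2)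
  have hpos: "0 < h" using h0 c0 by simp
  have "c\<^sup>2 \<le> h\<^sup>2" using h0 c0 by (intro power_mono) auto
  then have "\<alpha>\<^sup>2 \<le> s\<^sup>2" using ah sc by linarith
  then have "\<alpha> \<le> s" using s0 by (simp add: power2_le_iff_abs_le)
  then have c\<alpha>: "c * \<alpha> \<le> s * h" using mult_mono[OF h0 \<open>\<alpha> \<le> s\<close>] hpos x by (simp add: mult.commute)
  \<comment> \<open>\<open>x\<close> satisfies the tangent inequality at \<open>a\<close>\<close>
  have "0 \<le> (\<alpha> - s)\<^sup>2 + (h - c)\<^sup>2" by simp
  then have \<alpha>s: "\<alpha> * s + c * h \<le> 1" using ah sc by (simp add: power2_diff algebra_simps)
  obtain z where z: "z \<in> K" "0 \<le> det2 xv z" "0 \<le> det2 z bv" "\<And>v. v \<in> K \<Longrightarrow> v \<bullet> N \<le> z \<bullet> N"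
    using highest_chord_point[OF K(1,5) s0 c0 sc x(1,2) h0 h1 x(3) bK[unfolded bv_def]]
    unfolding xv_def bv_def N_def by blast
  define m where "m = z \<bullet> N"
  have m: "\<alpha> * c + s * h \<le> m"
    using z(4)[OF x(1)] by (simp add: m_def inner_vec2 N_def algebra_simps)
  have "0 < s * h" using s0 hpos by simp
  moreover have "0 \<le> \<alpha> * c" using x c0 by simp
  ultimately have mpos: "0 < m" and dxb: "0 < det2 xv bv"
    using m by (auto simp: det2_def xv_def bv_def mult.commute)
  have dab: "0 < det2 av bv" using s0 c0 by (simp add: av_def bv_def det2_def)
  have dax: "0 \<le> det2 av xv" "det2 av xv = s * h - c * \<alpha>" using c\<alpha> by (simp_all add: av_def xv_def det2_def)
  \<comment> \<open>the Pluecker relation shows that \<open>z\<close> is not clockwise of \<open>a\<close>\<close>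
  have "det2 av z * det2 xv bv = det2 av xv * det2 z bv + det2 av bv * det2 xv z"
    by (simp add: det2_def algebra_simps)
  then have "0 \<le> det2 av z * det2 xv bv" using dab dax z by simp
  then have daz: "0 \<le> det2 av z" using dxb by (simp add: zero_le_mult_iff)
  have av0: "av \<noteq> 0" using s0 by (auto simp: av_def vec2_eq_iff)
  have "0 \<in> K" using K(3) interior_subset by blast
  then have "real n * ((det2 av xv + det2 xv z + det2 z bv) / 2) \<le> measure lebesgue K"
    using a z dxb dax daz x K av0 b
    by (intro fan_area[OF n \<theta>]) (auto simp: av_def[symmetric] xv_def[symmetric] lmeasurable_compact)
  moreover have "det2 xv z + det2 z bv = m"
    by (simp add: m_def det2_def xv_def bv_def N_def inner_vec2 algebra_simps)
  ultimately have area1: "real n * ((s * h - c * \<alpha> + m) / 2) \<le> area K"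
    using dax by (simp add: area_def add.assoc)
  define w u :: "real^2" where "w = vector [0, 1 / h]" and "u = (1 / m) *\<^sub>R N"
  have unit: "v \<in> polar K" if "norm v = 1" for v
    unfolding polar_def
  proof (intro CollectI ballI)
    fix y assume "y \<in> K"
    then have "norm v * norm y \<le> 1" using K(5) that by auto
    then show "v \<bullet> y \<le> 1" using norm_cauchy_schwarz order_trans by blast
  qed
  have avp: "av \<in> polar K" using sc
    by (intro unit) (simp add: norm_eq_sqrt_inner inner_vec2 av_def power2_eq_square)
  have wp: "w \<in> polar K" using x(3) hpos by (simp add: polar_def w_def inner_vec2)
  have up: "u \<in> polar K" using z(4) mpos
    by (simp add: polar_def u_def m_def inner_commute[of N])
  have d1: "det2 av w = s / h" by (simp add: det2_def av_def w_def)
  have d2: "det2 w u = (h - c) / h / m" using hpos mpos by (simp add: det2_def w_def u_def N_def field_simps)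
  have d3: "det2 u bv = (s * (\<alpha> + s) - c * (h - c)) / m"
    by (simp add: det2_def bv_def u_def N_def diff_divide_distrib add_divide_distrib algebra_simps)
  have d4: "det2 av u = (s * (\<alpha> + s) + c * (h - c)) / m"
    by (simp add: det2_def av_def u_def N_def diff_divide_distrib add_divide_distrib algebra_simps)
  have d5: "det2 w bv = s / h" by (simp add: det2_def bv_def w_def)
  have "(h - c) * c \<le> (1 - c) * (1 + c)" using h0 h1 c0 by (intro mult_mono) auto
  also have "\<dots> = s\<^sup>2" using sc by (simp add: algebra_simps power2_eq_square)
  also have "\<dots> \<le> s * (\<alpha> + s)" using s0 x by (simp add: power2_eq_square)
  finally have "0 \<le> s * (\<alpha> + s) - c * (h - c)" by (simp add: mult.commute)
  then have "real n * ((det2 av w + det2 w u + det2 u bv) / 2) \<le> measure lebesgue (polar K)"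
    using s0 hpos mpos h0 c0 x(2)
    by (intro fan_area[OF n \<theta> lmeasurable_compact[OF polar_compact[OF K(3)]]
          polar_rotation[OF K(4)] polar_convex _ avp wp up av0 b])
      (simp_all add: d1 d2 d3 d4 d5, simp add: polar_def)
  moreover have "det2 av w + det2 w u + det2 u bv = s / h + ((h - c) / h + s * (\<alpha> + s) - c * (h - c)) / m"
    unfolding d1 d2 d3 by (simp add: add_divide_distrib diff_divide_distrib)
  ultimately have area2: "real n * ((s / h + ((h - c) / h + s * (\<alpha> + s) - c * (h - c)) / m) / 2) \<le> area (polar K)"
    by (simp add: area_def)
  have "N * (S + P / 4) = N / 4 * (4 * S + P)" for N S P :: real
    by (simp add: field_simps)
  then have "(real n)\<^sup>2 * (s\<^sup>2 + (1 - c / h) * (1 - c * h) / 4) = (real n)\<^sup>2 / 4 * (4 * s\<^sup>2 + (1 - c / h) * (1 - c * h))" .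
  also have "\<dots> \<le> (real n)\<^sup>2 / 4 * ((s * h - c * \<alpha> + m) * (s / h + ((h - c) / h + s * (\<alpha> + s) - c * (h - c)) / m))"
    using s0 sc hpos h0 x(2) c0 c\<alpha> \<alpha>s m by (intro mult_left_mono sector_product_bound) auto
  also have "\<dots> = (real n * ((s * h - c * \<alpha> + m) / 2)) * (real n * ((s / h + ((h - c) / h + s * (\<alpha> + s) - c * (h - c)) / m) / 2))"
    by (simp add: power2_eq_square)
  also have "\<dots> \<le> area K * area (polar K)"
    using area1 area2 dax mpos \<open>0 \<le> s * (\<alpha> + s) - c * (h - c)\<close> s0 hpos h0
    by (intro mult_mono) (auto simp: area_def simp flip: add_diff_eq)
  finally show ?thesis .
qed

section \<open>Regular polygons\<close>

text \<open>
  The vertex \<open>a\<close> is arbitrary, so this covers every regular \<open>n\<close>-gon centred at the origin.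
\<close>
definition ngon :: "nat \<Rightarrow> real^2 \<Rightarrow> (real^2) set" where
  "ngon n a = convex hull {rotation (2 * pi * real k / real n) a | k. k < n}"

lemma rotation_periodic_nat: "rotation (t + 2 * pi * real m) v = rotation t v"
proof -
  have "2 * pi * real m = 2 * real m * pi" by simp
  then have "rotation (2 * pi * real m) v = v"
    by (simp only: vec2_eq_iff rotation_component sin_2npi cos_2npi) simp
  then show ?thesis by (simp flip: rotation_rotation)
qed

lemma rotation_in_ngon:
  assumes "n > 0"
  shows "rotation (2 * pi * real k / real n) a \<in> ngon n a"
proof -
  have "real k = real (k mod n) + real n * real (k div n)"
    by (metis add.commute mult_div_mod_eq of_nat_add of_nat_mult)
  then have "2 * pi * real k / real n = 2 * pi * real (k mod n) / real n + 2 * pi * real (k div n)"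
    using assms by (simp add: field_simps)
  then have "rotation (2 * pi * real k / real n) a = rotation (2 * pi * real (k mod n) / real n) a"
    by (simp add: rotation_periodic_nat)
  then show ?thesis
    unfolding ngon_def using assms by (intro hull_inc) (auto intro!: exI[of _ "k mod n"])
qed

lemma ngon_subset:
  assumes "convex K" "rotation (2 * pi / real n) ` K = K" "a \<in> K"
  shows "ngon n a \<subseteq> K"
  unfolding ngon_def
proof (rule hull_minimal)
  show "{rotation (2 * pi * real k / real n) a | k. k < n} \<subseteq> K"
    using invariant_rotation_iterate[OF assms(2,3)] by (auto simp: mult.commute)
qed (rule assms)

lemma convex_zero_combination:
  assumes "convex S" "0 \<in> S" "x \<in> S" "y \<in> S" "0 \<le> p" "0 \<le> q" "p + q \<le> 1"
  shows "p *\<^sub>R x + q *\<^sub>R y \<in> S"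
proof (cases "p + q = 0")
  case True
  then have "p = 0" "q = 0" using assms by linarith+
  then show ?thesis using assms by simp
next
  case False
  have "(1 - (p + q)) *\<^sub>R 0 + (p + q) *\<^sub>R ((p / (p + q)) *\<^sub>R x + (q / (p + q)) *\<^sub>R y) \<in> S"
    using assms False by (intro convexD_alt mem_convex_alt) auto
  then show ?thesis using False by (simp add: scaleR_add_right)
qed

lemma ngon_compact: "compact (ngon n a)"
proof -
  have "{rotation (2 * pi * real k / real n) a | k. k < n} = (\<lambda>k. rotation (2 * pi * real k / real n) a) ` {..<n}"
    by auto
  then show ?thesis unfolding ngon_def by (intro compact_convex_hull finite_imp_compact) simp
qed

lemma ngon_convex: "convex (ngon n a)"
  by (simp add: ngon_def)

lemma rotation_ngon:
  assumes "n > 0"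
  shows "rotation (2 * pi / real n) ` ngon n a = ngon n a"
proof
  let ?\<theta> = "2 * pi / real n"
  have r: "rotation ?\<theta> (rotation (2 * pi * real k / real n) a) = rotation (2 * pi * real (Suc k) / real n) a" for k
    by (simp add: rotation_rotation add_divide_distrib[symmetric] algebra_simps)
  have "rotation ?\<theta> ` ngon n a = convex hull (rotation ?\<theta> ` {rotation (2 * pi * real k / real n) a | k. k < n})"
    unfolding ngon_def by (rule convex_hull_linear_image[OF linear_rotation])
  also have "\<dots> \<subseteq> ngon n a"
    using rotation_in_ngon[OF assms] r by (intro hull_minimal ngon_convex) (auto simp del: of_nat_Suc)
  finally show sub: "rotation ?\<theta> ` ngon n a \<subseteq> ngon n a" .
  have "{rotation (2 * pi * real k / real n) a | k. k < n} \<subseteq> rotation ?\<theta> ` ngon n a"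
  proof
    fix x assume "x \<in> {rotation (2 * pi * real k / real n) a | k. k < n}"
    then obtain k where k: "x = rotation (2 * pi * real k / real n) a" by blast
    have "x = rotation (2 * pi * real (Suc (k + (n - 1))) / real n) a"
    proof -
      have "2 * pi * real (Suc (k + (n - 1))) / real n = 2 * pi * real k / real n + 2 * pi * real 1"
        using assms by (simp add: field_simps of_nat_diff)
      then show ?thesis using k rotation_periodic_nat by metis
    qed
    then have "x = rotation ?\<theta> (rotation (2 * pi * real (k + (n - 1)) / real n) a)" by (simp only: r)
    then show "x \<in> rotation ?\<theta> ` ngon n a" using rotation_in_ngon[OF assms] by blast
  qed
  then show "ngon n a \<subseteq> rotation ?\<theta> ` ngon n a"
    unfolding ngon_def[of n a]
    by (intro hull_minimal) (simp_all add: convex_linear_image linear_rotation ngon_convex flip: ngon_def)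
qed

text \<open>
  The sum is fixed by a rotation through an angle strictly between \<open>0\<close> and \<open>2 * pi\<close>.
\<close>
lemma sum_rotations_eq_0:
  assumes n: "n \<ge> 2"
  shows "(\<Sum>k<n. rotation (real k * (2 * pi / real n)) v) = 0"
proof -
  let ?\<theta> = "2 * pi / real n"
  let ?S = "\<Sum>k<n. rotation (real k * ?\<theta>) v"
  have "rotation ?\<theta> ?S = (\<Sum>k<n. rotation ?\<theta> (rotation (real k * ?\<theta>) v))"
    by (rule linear_sum[OF linear_rotation])
  also have "\<dots> = (\<Sum>k<n. rotation (real (Suc k) * ?\<theta>) v)"
    by (intro sum.cong) (simp_all add: rotation_rotation distrib_right add_divide_distrib)
  also have "\<dots> + rotation (real 0 * ?\<theta>) v = (\<Sum>k<Suc n. rotation (real k * ?\<theta>) v)"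
    by (subst sum.lessThan_Suc_shift) simp
  also have "\<dots> = ?S + rotation (real n * ?\<theta>) v" by simp
  also have "rotation (real n * ?\<theta>) v = v" using n by (simp add: rotation_2pi)
  finally have eq: "rotation ?\<theta> ?S = ?S" by simp
  have lt: "0 < ?\<theta>" "?\<theta> \<le> pi" using n by (auto simp: field_simps)
  show ?thesis
  proof (rule ccontr)
    assume "?S \<noteq> 0"
    then have "?\<theta> = 0" using eq lt pi_gt_zero by (intro rotation_inject[of ?\<theta> ?S 0]) (simp_all del: pi_gt_zero)
    then show False using lt by simp
  qed
qed

lemma zero_in_ngon:
  assumes "n \<ge> 2"
  shows "0 \<in> ngon n a"
proof -
  have "(\<Sum>k<n. (1 / real n) *\<^sub>R rotation (2 * pi * real k / real n) a) \<in> ngon n a"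
    using assms rotation_in_ngon by (intro convex_sum ngon_convex) auto
  moreover have "(\<Sum>k<n. (1 / real n) *\<^sub>R rotation (2 * pi * real k / real n) a) = 0"
    using sum_rotations_eq_0[OF assms, of a] by (simp add: mult_ac flip: scaleR_sum_right)
  ultimately show ?thesis by simp
qed

text \<open>
  The point is a nonnegative combination \<open>p * a' + q * b'\<close> of two neighbouring vertices.  Both
  vertices have inner product \<open>cos (pi / n)\<close> with the normal of their side, so the half-plane of
  that side says \<open>p + q \<le> 1\<close>.
\<close>
lemma halfplanes_subset_ngon:
  assumes n: "n \<ge> 3" and a: "norm a = 1"
    and v: "\<And>k. v \<bullet> rotation ((2 * real k + 1) * (pi / real n)) a \<le> cos (pi / real n)"
  shows "v \<in> ngon n a"
proof (cases "v = 0")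
  case True
  then show ?thesis using zero_in_ngon n by simp
next
  case False
  have a0: "a \<noteq> 0" using a by auto
  define \<theta> where "\<theta> = 2 * pi / real n"
  have \<theta>: "0 < \<theta>" "\<theta> < pi" using n by (simp_all add: \<theta>_def field_simps)
  obtain r t where rt: "r > 0" "0 \<le> t" "t < 2 * pi" "v = r *\<^sub>R rotation t a"
    using polar_coordinates[OF a0 False] by metis
  define k where "k = nat \<lfloor>t / \<theta>\<rfloor>"
  have "real k = of_int \<lfloor>t / \<theta>\<rfloor>" using rt \<theta> by (simp add: k_def)
  then have "real k \<le> t / \<theta>" "t / \<theta> < real k + 1" by linarith+
  then have k: "real k * \<theta> \<le> t" "t < (real k + 1) * \<theta>" using \<theta> by (simp_all add: field_simps)
  define p where "p = r * sin ((real k + 1) * \<theta> - t) / sin \<theta>"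
  define q where "q = r * sin (t - real k * \<theta>) / sin \<theta>"
  have s0: "0 < sin \<theta>" using \<theta> by (rule sin_gt_zero)
  have pq0: "0 \<le> p" "0 \<le> q"
    using rt s0 k \<theta> by (auto simp: p_def q_def algebra_simps intro!: divide_nonneg_pos mult_nonneg_nonneg sin_ge_zero)
  let ?a = "rotation (2 * pi * real k / real n) a" and ?b = "rotation (2 * pi * real (Suc k) / real n) a"
  have ab: "?a = rotation (real k * \<theta>) a" "?b = rotation ((real k + 1) * \<theta>) a"
    by (simp_all add: \<theta>_def mult_ac add.commute)
  have vpq: "v = p *\<^sub>R ?a + q *\<^sub>R ?b"
  proof -
    have e: "rotation t a = rotation (t - real k * \<theta>) (rotation (real k * \<theta>) a)"
      "rotation ((real k + 1) * \<theta>) a = rotation \<theta> (rotation (real k * \<theta>) a)"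
      by (simp_all add: rotation_rotation algebra_simps)
    have "sin \<theta> *\<^sub>R rotation u w = sin (\<theta> - u) *\<^sub>R w + sin u *\<^sub>R rotation \<theta> w" for u w
      by (simp add: vec2_eq_iff sin_diff algebra_simps)
    from this[of "t - real k * \<theta>" "rotation (real k * \<theta>) a"]
    have "sin \<theta> *\<^sub>R rotation t a = sin ((real k + 1) * \<theta> - t) *\<^sub>R ?a + sin (t - real k * \<theta>) *\<^sub>R ?b"
      unfolding ab e(1) e(2) by (simp add: algebra_simps)
    then have "(r / sin \<theta>) *\<^sub>R (sin \<theta> *\<^sub>R rotation t a)
        = (r / sin \<theta>) *\<^sub>R (sin ((real k + 1) * \<theta> - t) *\<^sub>R ?a + sin (t - real k * \<theta>) *\<^sub>R ?b)"
      by (rule arg_cong)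
    then show ?thesis
      unfolding rt(4) using s0 by (simp add: p_def q_def scaleR_add_right)
  qed
  have half: "\<theta> / 2 = pi / real n" by (simp add: \<theta>_def)
  have aa: "a \<bullet> a = 1" using a by (simp add: dot_square_norm)
  have rr: "rotation u a \<bullet> rotation w a = cos (u - w)" for u w
  proof -
    have "rotation u a \<bullet> rotation w a = cos (u - w) * (a \<bullet> a)"
      by (simp add: inner_vec2 cos_diff algebra_simps)
    then show ?thesis by (simp add: aa)
  qed
  have "v \<bullet> rotation ((2 * real k + 1) * (pi / real n)) a = (p + q) * cos (pi / real n)"
    unfolding vpq ab inner_add_left inner_scaleR_left rr
    by (simp add: half[symmetric] algebra_simps)
  moreover have c0: "0 < cos (pi / real n)"
    using \<theta> half by (intro cos_gt_zero_pi) linarith+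
  ultimately have "p + q \<le> 1" using v[of k] by simp
  then have "p *\<^sub>R ?a + q *\<^sub>R ?b \<in> ngon n a"
    using pq0 n by (intro convex_zero_combination ngon_convex rotation_in_ngon zero_in_ngon) auto
  then show ?thesis using vpq by simp
qed

lemma cos_pi_over_ge_half:
  assumes "n \<ge> 3"
  shows "1 / 2 \<le> cos (pi / real n)"
proof -
  have "cos (pi / 3) \<le> cos (pi / real n)"
    using assms by (intro cos_monotone_0_pi_le) (auto simp: field_simps)
  then show ?thesis by (simp add: cos_60)
qed

lemma half_disc_subset_ngon:
  assumes n: "n \<ge> 3" and a: "norm a = 1"
  shows "cball 0 (1/2) \<subseteq> ngon n a"
proof
  fix v :: "real^2" assume "v \<in> cball 0 (1/2)"
  then have v: "norm v \<le> 1/2" by simp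
  show "v \<in> ngon n a"
  proof (rule halfplanes_subset_ngon[OF n a])
    fix k
    have "v \<bullet> rotation ((2 * real k + 1) * (pi / real n)) a \<le> norm v * norm (rotation ((2 * real k + 1) * (pi / real n)) a)"
      by (rule norm_cauchy_schwarz)
    then show "v \<bullet> rotation ((2 * real k + 1) * (pi / real n)) a \<le> cos (pi / real n)"
      using v a cos_pi_over_ge_half[OF n] by simp
  qed
qed

section \<open>The centre of polarity\<close>

lemma zero_interior_of_half_disc_subset:
  fixes K :: "(real^2) set"
  assumes "cball 0 (1/2) \<subseteq> K"
  shows "0 \<in> interior K"
  using interior_mono[OF assms] by (force simp: interior_cball)

lemma absolutely_integrable_on_compact:
  fixes f :: "'a::euclidean_space \<Rightarrow> 'b::euclidean_space"
  assumes "compact S" "continuous_on S f"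
  shows "f absolutely_integrable_on S"
proof -
  have i: "integrable lborel (\<lambda>x. indicator S x *\<^sub>R f x)"
    using borel_integrable_compact[OF assms] .
  then have "(\<lambda>x. indicator S x *\<^sub>R f x) \<in> lborel \<rightarrow>\<^sub>M borel" by (rule borel_measurable_integrable)
  from integrable_completion[OF this] i show ?thesis by (simp add: set_integrable_def)
qed

lemma integrable_on_compact:
  fixes f :: "'a::euclidean_space \<Rightarrow> 'b::euclidean_space"
  assumes "compact S" "continuous_on S f"
  shows "f integrable_on S"
  using absolutely_integrable_on_compact[OF assms] absolutely_integrable_on_def by blast

text \<open>
  The integral of the identity over \<open>P\<close> is a vector fixed by the rotation, hence zero: the origin is
  the centroid of \<open>P\<close>.
\<close>
lemma integral_inner_rotation_invariant:
  fixes P :: "(real^2) set"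
  assumes n: "n \<ge> 2" and P: "compact P" "rotation (2 * pi / real n) ` P = P"
  shows "integral P (\<lambda>z. z \<bullet> p) = 0"
proof -
  let ?\<theta> = "2 * pi / real n"
  define F where "F = integral P (\<lambda>z. z)"
  have int: "(\<lambda>z. z) integrable_on P" using P(1) by (intro integrable_on_compact continuous_intros)
  have bl: "bounded_linear (rotation ?\<theta>)" using linear_rotation linear_conv_bounded_linear by blast
  have "F = integral (rotation ?\<theta> ` P) (\<lambda>z. z)" by (simp add: F_def P)
  also have "\<dots> = \<bar>det (matrix (rotation ?\<theta>))\<bar> *\<^sub>R integral P ((\<lambda>z. z) \<circ> rotation ?\<theta>)"
    using P by (intro integral_change_of_variables_linear linear_rotation)
      (auto intro!: absolutely_integrable_on_compact continuous_intros)
  also have "\<dots> = integral P (rotation ?\<theta> \<circ> (\<lambda>z. z))"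
    using orthogonal_transformation_det[OF orthogonal_transformation_rotation] by (simp add: o_def)
  also have "\<dots> = rotation ?\<theta> F" unfolding F_def by (rule integral_linear[OF int bl])
  finally have eq: "rotation ?\<theta> F = rotation 0 F" by simp
  have lt: "0 < ?\<theta>" "?\<theta> \<le> pi" using n by (auto simp: field_simps)
  have "F = 0"
  proof (rule ccontr)
    assume "F \<noteq> 0"
    then have "?\<theta> = 0" using eq lt pi_gt_zero by (intro rotation_inject[of ?\<theta> F 0]) (simp_all del: pi_gt_zero)
    then show False using lt by simp
  qed
  have "integral P (\<lambda>z. z \<bullet> p) = integral P ((\<lambda>z. z \<bullet> p) \<circ> (\<lambda>z. z))" by (simp add: o_def)
  also have "\<dots> = F \<bullet> p" unfolding F_def by (rule integral_linear[OF int bounded_linear_inner_left])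
  finally show ?thesis using \<open>F = 0\<close> by simp
qed

text \<open>
  On the disc of radius \<open>1 / 4\<close> about the point of norm \<open>3 / 4\<close> in direction \<open>p\<close>, the inner product is
  at least \<open>norm p / 2\<close>.
\<close>
lemma integral_inner_square_lower_bound:
  fixes P :: "(real^2) set"
  assumes P: "compact P" "cball 0 1 \<subseteq> P"
  shows "pi / 64 * (norm p)\<^sup>2 \<le> integral P (\<lambda>z. (z \<bullet> p)\<^sup>2)"
proof (cases "p = 0")
  case False
  define q where "q = (3 / 4 / norm p) *\<^sub>R p"
  let ?B = "cball q (1/4)"
  have nq: "norm q = 3/4" using False by (simp add: q_def)
  have "?B \<subseteq> cball 0 1"
  proof
    fix z assume "z \<in> ?B"
    then have "norm (z - q) \<le> 1/4" by (simp add: dist_norm norm_minus_commute)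
    then show "z \<in> cball 0 1" using norm_triangle_ineq[of "z - q" q] nq by simp
  qed
  then have BP: "?B \<subseteq> P" using P by blast
  have on_ball: "(norm p)\<^sup>2 / 4 \<le> (z \<bullet> p)\<^sup>2" if "z \<in> ?B" for z
  proof -
    have "norm (z - q) \<le> 1/4" using that by (simp add: dist_norm norm_minus_commute)
    then have "norm (z - q) * norm p \<le> 1/4 * norm p" by (intro mult_right_mono) auto
    moreover have "- (norm (z - q) * norm p) \<le> (z - q) \<bullet> p"
      using Cauchy_Schwarz_ineq2[of "z - q" p] by linarith
    moreover have "q \<bullet> p = 3/4 * norm p" using False by (simp add: q_def dot_square_norm power2_eq_square)
    ultimately have "norm p / 2 \<le> z \<bullet> p" by (simp add: inner_diff_left)
    then have "(norm p / 2)\<^sup>2 \<le> (z \<bullet> p)\<^sup>2" by (intro power_mono) auto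
    then show ?thesis by (simp add: power_divide)
  qed
  have int: "(\<lambda>z. (z \<bullet> p)\<^sup>2) integrable_on P" "(\<lambda>z. (z \<bullet> p)\<^sup>2) integrable_on ?B"
    "(\<lambda>z::real^2. (norm p)\<^sup>2 / 4) integrable_on ?B"
    using P by (auto intro!: integrable_on_compact continuous_intros)
  have "measure lebesgue ?B = measure lborel ?B" by (intro measure_completion) simp
  also have "\<dots> = pi / 16" by (simp add: content_cball unit_ball_vol_2 power2_eq_square)
  finally have mB: "measure lebesgue ?B = pi / 16" .
  have "pi / 64 * (norm p)\<^sup>2 = (norm p)\<^sup>2 / 4 * measure lebesgue ?B"
    unfolding mB by simp
  also have "measure lebesgue ?B = integral ?B (\<lambda>z. 1)"
    by (intro lmeasure_integral lmeasurable_compact) simp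
  also have "(norm p)\<^sup>2 / 4 * \<dots> = integral ?B (\<lambda>z. (norm p)\<^sup>2 / 4 * 1)" by (rule integral_mult_right[symmetric])
  also have "\<dots> \<le> integral ?B (\<lambda>z. (z \<bullet> p)\<^sup>2)"
    using int on_ball by (intro integral_le) auto
  also have "\<dots> \<le> integral P (\<lambda>z. (z \<bullet> p)\<^sup>2)"
    using int BP by (intro integral_subset_le) auto
  finally show ?thesis .
qed simp

text \<open>
  Multiplied by \<open>(1 + t) ^ 3\<close>, the difference of the two sides becomes \<open>t\<^sup>2 * (5 + 5 * t - t ^ 3)\<close>.
\<close>
lemma inverse_cube_lower_bound:
  fixes t :: real
  assumes "-1 < t" "t \<le> 2"
  shows "1 - 3 * t + t\<^sup>2 \<le> 1 / (1 + t) ^ 3"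
proof -
  have "0 \<le> 5 + 5 * t - t ^ 3"
  proof (cases "0 \<le> t")
    case True
    have "t ^ 3 = t * t\<^sup>2" by (simp add: power2_eq_square power3_eq_cube)
    also have "\<dots> \<le> t * 2\<^sup>2" using True assms by (intro mult_left_mono power_mono) auto
    finally show ?thesis using assms True by simp
  next
    case False
    then have "t ^ 3 \<le> 0" by (simp add: power_le_zero_eq)
    then show ?thesis using assms by linarith
  qed
  then have "0 \<le> t\<^sup>2 * (5 + 5 * t - t ^ 3)" by simp
  also have "\<dots> = 1 - (1 - 3 * t + t\<^sup>2) * (1 + t) ^ 3" by algebra
  finally show ?thesis using assms by (simp add: pos_le_divide_eq)
qed

text \<open>
  The derivative of \<open>g\<close> is a rank one perturbation of a multiple of the identity, with determinant
  \<open>(1 + z \<bullet> p) ^ (-3)\<close>.  This \<open>g\<close> is the projective map that relates the polars of a body about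
  different centres.
\<close>
lemma projective_map_measure:
  fixes P :: "(real^2) set"
  assumes P: "compact P" "\<And>z. z \<in> P \<Longrightarrow> -1 < z \<bullet> p"
  defines "g \<equiv> \<lambda>z. (1 / (1 + z \<bullet> p)) *\<^sub>R z"
  shows "g ` P \<in> lmeasurable" "measure lebesgue (g ` P) = integral P (\<lambda>z. 1 / (1 + z \<bullet> p) ^ 3)"
proof -
  define g' where "g' = (\<lambda>z w. (1 / (1 + z \<bullet> p)) *\<^sub>R w - ((w \<bullet> p) / (1 + z \<bullet> p)\<^sup>2) *\<^sub>R z)"
  have pos: "0 < 1 + z \<bullet> p" if "z \<in> P" for z using P(2)[OF that] by simp
  have der: "(g has_derivative g' z) (at z within P)" if "z \<in> P" for z
    unfolding g_def g'_def using pos[OF that]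
    by (auto intro!: derivative_eq_intros simp: power2_eq_square divide_inverse)
  have inj: "inj_on g P"
  proof (rule inj_onI)
    fix y z assume yz: "y \<in> P" "z \<in> P" "g y = g z"
    then have "g y \<bullet> p = g z \<bullet> p" by simp
    then have "y \<bullet> p = z \<bullet> p" using pos[OF yz(1)] pos[OF yz(2)]
      by (simp add: g_def frac_eq_eq algebra_simps)
    then show "y = z" using yz(3) pos[OF yz(1)] by (simp add: g_def)
  qed
  have det: "\<bar>det (matrix (g' z))\<bar> = 1 / (1 + z \<bullet> p) ^ 3" if "z \<in> P" for z
  proof -
    define u where "u = 1 + z \<bullet> p"
    have u: "0 < u" using pos[OF that] by (simp add: u_def)
    have ax: "axis (1::2) (1::real) $ 1 = 1" "axis (1::2) (1::real) $ 2 = 0"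
      "axis (2::2) (1::real) $ 1 = 0" "axis (2::2) (1::real) $ 2 = 1"
      by (simp_all add: axis_def)
    have "det (matrix (g' z)) = (1 / u - p$1 / u\<^sup>2 * z$1) * (1 / u - p$2 / u\<^sup>2 * z$2)
        - (p$2 / u\<^sup>2 * z$1) * (p$1 / u\<^sup>2 * z$2)"
      by (simp add: det_2 matrix_def g'_def u_def inner_axis' ax)
    also have "\<dots> = (1 / u)\<^sup>2 - (z \<bullet> p) / u ^ 3"
      using u by (simp add: inner_vec2 field_simps power2_eq_square power3_eq_cube)
    also have "\<dots> = 1 / u ^ 3"
    proof -
      have "z \<bullet> p = u - 1" by (simp add: u_def)
      then show ?thesis using u by (simp add: field_simps power2_eq_square power3_eq_cube)
    qed
    finally show ?thesis using u by (simp add: u_def)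
  qed
  have "continuous_on P g" unfolding g_def using pos by (force intro!: continuous_intros)
  then have "compact (g ` P)" using P(1) compact_continuous_image by blast
  then show meas: "g ` P \<in> lmeasurable" by (rule lmeasurable_compact)
  have S: "P \<in> sets lebesgue" using P(1) by (simp add: fmeasurableD lmeasurable_compact)
  have "(\<lambda>z. \<bar>det (matrix (g' z))\<bar>) integrable_on P"
    using measurable_differentiable_image_eq[OF S der inj] meas by blast
  from measure_differentiable_image_eq[OF S der inj this]
  have "measure lebesgue (g ` P) = integral P (\<lambda>z. \<bar>det (matrix (g' z))\<bar>)" .
  also have "\<dots> = integral P (\<lambda>z. 1 / (1 + z \<bullet> p) ^ 3)"
    using det by (intro integral_cong) auto
  finally show "measure lebesgue (g ` P) = integral P (\<lambda>z. 1 / (1 + z \<bullet> p) ^ 3)" .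
qed

text \<open>
  Quantitative form of the fact that the centre of symmetry is the Santalo point of \<open>K\<close>: the polar
  of the translate contains the projective image of \<open>P = polar K\<close>, and the expansion of the Jacobian
  has vanishing first order integral.  The two discs bound \<open>z \<bullet> p\<close> by \<open>2\<close> on \<open>P\<close>, the range in which
  the quadratic lower bound holds.
\<close>
lemma santalo_stability:
  fixes K :: "(real^2) set"
  assumes n: "n \<ge> 2" and K: "rotation (2 * pi / real n) ` K = K" "K \<subseteq> cball 0 1" "cball 0 (1/2) \<subseteq> K"
    and p: "- p \<in> interior K"
  shows "area (polar K) + pi / 64 * (norm p)\<^sup>2 \<le> area (polar ((+) p ` K))"
proof -
  define P where "P = polar K"
  have i0: "0 \<in> interior K"
    using interior_mono[OF K(3)] by (force simp: interior_cball)
  have cP: "compact P" using i0 by (simp add: P_def polar_compact)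
  have rP: "rotation (2 * pi / real n) ` P = P" by (simp add: P_def polar_rotation K)
  have ball: "cball 0 1 \<subseteq> P"
  proof
    fix z :: "real^2" assume z: "z \<in> cball 0 1"
    show "z \<in> P" unfolding P_def polar_def
    proof (intro CollectI ballI)
      fix y assume "y \<in> K"
      then have "norm z * norm y \<le> 1 * 1" using z K(2) by (intro mult_mono) auto
      then show "z \<bullet> y \<le> 1" using norm_cauchy_schwarz[of z y] by simp
    qed
  qed
  have low: "- 1 < z \<bullet> p" if "z \<in> P" for z
  proof (cases "z = 0")
    case False
    obtain e where e: "e > 0" "cball (- p) e \<subseteq> K" using p mem_interior_cball by blast
    have "- p + (e / norm z) *\<^sub>R z \<in> K" using e(1) False by (intro set_mp[OF e(2)]) (simp add: dist_norm)
    then have "z \<bullet> (- p + (e / norm z) *\<^sub>R z) \<le> 1" using that by (auto simp: P_def polar_def)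
    then have "e * norm z \<le> 1 + z \<bullet> p"
      using False by (simp add: inner_add_right inner_diff_right dot_square_norm power2_eq_square)
    moreover have "0 < e * norm z" using e False by simp
    ultimately show ?thesis by linarith
  qed simp
  have np: "norm p \<le> 1" using p K(2) interior_subset by fastforce
  have up: "z \<bullet> p \<le> 2" if "z \<in> P" for z
  proof (cases "z = 0")
    case False
    have "(1 / 2 / norm z) *\<^sub>R z \<in> K" using False by (intro set_mp[OF K(3)]) simp
    then have "z \<bullet> ((1 / 2 / norm z) *\<^sub>R z) \<le> 1" using that by (auto simp: P_def polar_def)
    then have "norm z \<le> 2" using False by (simp add: dot_square_norm power2_eq_square)
    then have "norm z * norm p \<le> 2 * 1" using np by (intro mult_mono) auto
    then show ?thesis using norm_cauchy_schwarz[of z p] by simp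
  qed simp
  define g where "g = (\<lambda>z. (1 / (1 + z \<bullet> p)) *\<^sub>R z)"
  have gm: "g ` P \<in> lmeasurable" "measure lebesgue (g ` P) = integral P (\<lambda>z. 1 / (1 + z \<bullet> p) ^ 3)"
    using projective_map_measure[OF cP low] by (simp_all add: g_def)
  have sub: "g ` P \<subseteq> polar ((+) p ` K)"
  proof
    fix y assume "y \<in> g ` P"
    then obtain z where z: "z \<in> P" "y = g z" by blast
    show "y \<in> polar ((+) p ` K)" unfolding polar_def
    proof (intro CollectI ballI)
      fix w assume "w \<in> (+) p ` K"
      then obtain k where k: "k \<in> K" "w = p + k" by blast
      have "z \<bullet> k \<le> 1" using z k by (auto simp: P_def polar_def)
      then show "y \<bullet> w \<le> 1"
        using low[OF z(1)] k(2) z(2)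
        by (simp add: g_def inner_add_right pos_divide_le_eq flip: add_divide_distrib)
    qed
  qed
  have "0 \<in> interior ((+) p ` K)"
    using p unfolding interior_translation by (auto intro!: image_eqI[of 0 _ "- p"])
  then have m2: "polar ((+) p ` K) \<in> lmeasurable" by (simp add: lmeasurable_compact polar_compact)
  have int: "(\<lambda>z. 1 :: real) integrable_on P" "(\<lambda>z. z \<bullet> p) integrable_on P" "(\<lambda>z. 3 * (z \<bullet> p)) integrable_on P"
    "(\<lambda>z. (z \<bullet> p)\<^sup>2) integrable_on P"
    using cP by (auto intro!: integrable_on_compact continuous_intros)
  have int3: "(\<lambda>z. 1 / (1 + z \<bullet> p) ^ 3) integrable_on P"
    using cP low by (intro integrable_on_compact continuous_intros) fastforce+
  have "area (polar K) + pi / 64 * (norm p)\<^sup>2 \<le> integral P (\<lambda>z. 1) - 3 * integral P (\<lambda>z. z \<bullet> p) + integral P (\<lambda>z. (z \<bullet> p)\<^sup>2)"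
    using integral_inner_rotation_invariant[OF n cP rP] integral_inner_square_lower_bound[OF cP ball, of p] cP
    by (simp add: area_def P_def[symmetric] lmeasure_integral lmeasurable_compact)
  also have "\<dots> = integral P (\<lambda>z. 1 - 3 * (z \<bullet> p) + (z \<bullet> p)\<^sup>2)"
    using int by (simp add: integral_add integral_diff integrable_diff)
  also have "\<dots> \<le> integral P (\<lambda>z. 1 / (1 + z \<bullet> p) ^ 3)"
    using int int3 low up
    by (intro integral_le integrable_add integrable_diff inverse_cube_lower_bound) auto
  also have "\<dots> \<le> area (polar ((+) p ` K))"
    unfolding gm(2)[symmetric] area_def using gm(1) m2 sub by (intro measure_mono_fmeasurable) auto
  finally show ?thesis .
qed

section \<open>Stability about the centre of symmetry\<close>

text \<open>
  An isometry takes the bisector of the first sector to the second axis.  It is a rotation or a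
  reflection according to the side of the bisector on which the highest point \<open>x\<close> lies, so that its
  image has nonnegative first coordinate.
\<close>
lemma area_product_bound:
  fixes K :: "(real^2) set"
  assumes n: "n \<ge> 3" and sdef: "s = sin (pi / real n)" and cdef: "c = cos (pi / real n)"
    and K: "compact K" "convex K" "rotation (2 * pi / real n) ` K = K" "K \<subseteq> cball 0 1"
    and a: "a \<in> K" "norm a = 1"
    and x: "x \<in> K" "\<And>v. v \<in> K \<Longrightarrow> v \<bullet> rotation (pi / real n) a \<le> h" "h = x \<bullet> rotation (pi / real n) a"
  shows "(real n)\<^sup>2 * (s\<^sup>2 + (1 - c / h) * (1 - c * h) / 4) \<le> area K * area (polar K)"
proof -
  define \<theta> where "\<theta> = 2 * pi / real n"
  define e where "e = rotation (pi / real n) a"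
  have \<theta>2: "\<theta> = 2 * (pi / real n)" by (simp add: \<theta>_def)
  have ee: "e \<bullet> e = 1" using a by (simp add: e_def inner_rotation dot_square_norm)
  define \<sigma> :: real where "\<sigma> = (if 0 \<le> det2 x e then 1 else - 1)"
  have \<sigma>: "\<sigma> = 1 \<or> \<sigma> = - 1" by (simp add: \<sigma>_def)
  then have \<sigma>\<sigma>: "\<sigma> * \<sigma> = 1" by auto
  define T :: "real^2 \<Rightarrow> real^2" where "T = (\<lambda>v. vector [\<sigma> * det2 v e, v \<bullet> e])"
  have T: "orthogonal_transformation T"
    unfolding orthogonal_transformation_def
  proof (intro conjI allI)
    show "linear T"
      by (rule linearI) (simp_all add: T_def vec2_eq_iff inner_add_left algebra_simps)
    fix v w
    have "T v \<bullet> T w = (\<sigma> * \<sigma>) * (det2 v e * det2 w e) + (v \<bullet> e) * (w \<bullet> e)"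
      by (simp add: T_def inner_vec2[of "vector _"])
    also have "\<dots> = (v \<bullet> w) * (e \<bullet> e)"
      unfolding \<sigma>\<sigma> det2_def inner_vec2 by algebra
    finally show "T v \<bullet> T w = v \<bullet> w" using ee by simp
  qed
  have rotT: "rotation \<theta> (T v) = T (rotation (\<sigma> * \<theta>) v)" for v
    using \<sigma> by (auto simp: T_def vec2_eq_iff det2_def inner_vec2 algebra_simps)
  have rotK: "rotation (\<sigma> * \<theta>) ` K = K"
    using \<sigma> K(3) invariant_rotation_uminus[OF K(3)] by (auto simp: \<theta>_def)
  have TK: "rotation \<theta> ` T ` K = T ` K"
    using rotK by (metis (no_types, lifting) image_cong image_image rotT)
  have cos_e: "rotation u a \<bullet> e = cos (u - pi / real n)" for u
  proof -
    have "rotation u a \<bullet> e = cos (u - pi / real n) * (a \<bullet> a)"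
      by (simp add: e_def inner_vec2 cos_diff algebra_simps)
    then show ?thesis using a by (simp add: dot_square_norm)
  qed
  have sin_e: "det2 (rotation u a) e = sin (pi / real n - u)" for u
    using a by (simp add: e_def det2_rotation_self)
  have vertex: "vector [s, c] \<in> T ` K"
  proof (cases "\<sigma> = 1")
    case True
    have "T (rotation 0 a) = vector [s, c]"
      using cos_e[of 0] sin_e[of 0] True by (simp add: T_def sdef cdef)
    then show ?thesis using a by (auto intro!: image_eqI[of _ T a])
  next
    case False
    have "T (rotation \<theta> a) = vector [s, c]"
      using cos_e[of \<theta>] sin_e[of \<theta>] False \<sigma> by (simp add: T_def sdef cdef \<theta>2)
    moreover have "rotation \<theta> a \<in> K" using K(3) a by (auto simp: \<theta>_def)
    ultimately show ?thesis by (metis imageI)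
  qed
  have xT: "vector [\<sigma> * det2 x e, h] \<in> T ` K"
    using x by (auto simp: T_def e_def intro!: image_eqI[of _ _ x])
  have lin: "linear T" using T by (rule orthogonal_transformation_linear)
  have ball: "cball 0 (1/2) \<subseteq> K"
    using half_disc_subset_ngon[OF n a(2)] ngon_subset[OF K(2,3) a(1)] by blast
  then have i0: "0 \<in> interior K" by (rule zero_interior_of_half_disc_subset)
  have "(real n)\<^sup>2 * (s\<^sup>2 + (1 - c / h) * (1 - c * h) / 4) \<le> area (T ` K) * area (polar (T ` K))"
  proof (rule area_product_bound_upright[OF n \<theta>_def sdef cdef _ _ _ TK _ vertex xT])
    show "compact (T ` K)" using K(1) lin
      by (intro compact_continuous_image linear_continuous_on) (simp_all add: linear_conv_bounded_linear)
    show "convex (T ` K)" using K(2) lin by (simp add: convex_linear_image)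
    show "0 \<in> interior (T ` K)"
      unfolding interior_orthogonal_image[OF T] using i0 linear_0[OF lin] by (metis imageI)
    show "T ` K \<subseteq> cball 0 1"
      using K(4) orthogonal_transformation_norm[OF T] by auto
    show "0 \<le> \<sigma> * det2 x e" by (simp add: \<sigma>_def)
    show "v $ 2 \<le> h" if "v \<in> T ` K" for v using that x(2) by (auto simp: T_def e_def)
  qed
  also have "\<dots> = area K * area (polar K)"
    using area_orthogonal_image[OF T] K(1) i0 by (simp add: polar_orthogonal_image[OF T] polar_compact)
  finally show ?thesis .
qed

text \<open>
  The surplus \<open>(1 - c / h) * (1 - c * h) / 4\<close> is compared with \<open>s\<^sup>2 = (1 - c) * (1 + c)\<close>; the
  factors \<open>1 - c\<close>, which tend to zero for growing \<open>n\<close>, cancel.  The factor \<open>12\<close> is \<open>4 * (1 + c) / c\<close>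
  at its largest, for \<open>c = 1 / 2\<close>, the value of the triangle.
\<close>
lemma height_bound_algebra:
  fixes s c h \<epsilon> :: real
  assumes c: "1 / 2 \<le> c" "c < 1" and s: "s\<^sup>2 + c\<^sup>2 = 1" and h: "c \<le> h" "h \<le> 1" and "0 \<le> \<epsilon>"
    and le: "s\<^sup>2 + (1 - c / h) * (1 - c * h) / 4 \<le> (1 + \<epsilon>) * s\<^sup>2"
  shows "h \<le> (1 + 12 * \<epsilon>) * c"
proof -
  have hp: "0 < h" using c h by linarith
  have "(1 - c / h) * (1 - c) \<le> (1 - c / h) * (1 - c * h)"
    using c h hp by (intro mult_left_mono) (auto simp: mult_le_cancel_left2)
  also have "\<dots> \<le> 4 * \<epsilon> * s\<^sup>2" using le by (simp add: algebra_simps)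
  also have "s\<^sup>2 = (1 + c) * (1 - c)" using s by (simp add: algebra_simps power2_eq_square)
  finally have "(1 - c / h) * (1 - c) \<le> (4 * \<epsilon> * (1 + c)) * (1 - c)" by simp
  then have "1 - c / h \<le> 4 * \<epsilon> * (1 + c)" using c by simp
  then have "h - c \<le> 4 * \<epsilon> * (1 + c) * h" using hp by (simp add: field_simps)
  also have "\<dots> \<le> 4 * \<epsilon> * (3 * c) * 1"
    using c h hp assms(6) by (intro mult_mono) auto
  finally show ?thesis by (simp add: algebra_simps)
qed

lemma sector_height_product_bound:
  fixes K :: "(real^2) set"
  assumes n: "n \<ge> 3" and K: "compact K" "convex K" "rotation (2 * pi / real n) ` K = K" "K \<subseteq> cball 0 1"
    and a: "a \<in> K" "norm a = 1" and sdef: "s = sin (pi / real n)" and cdef: "c = cos (pi / real n)"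
  obtains h where "1 / 2 \<le> c" "c < 1" "c \<le> h" "h \<le> 1"
    "\<And>v. v \<in> K \<Longrightarrow> v \<bullet> rotation (pi / real n) a \<le> h"
    "(real n)\<^sup>2 * (s\<^sup>2 + (1 - c / h) * (1 - c * h) / 4) \<le> area K * area (polar K)"
proof -
  define e where "e = rotation (pi / real n) a"
  have "continuous_on K (\<lambda>v. v \<bullet> e)" by (intro continuous_intros)
  then obtain x where x: "x \<in> K" "\<And>v. v \<in> K \<Longrightarrow> v \<bullet> e \<le> x \<bullet> e"
    using continuous_attains_sup[OF K(1)] a by blast
  define h where "h = x \<bullet> e"
  have ne: "norm e = 1" using a by (simp add: e_def)
  have "a \<bullet> e = c * (a \<bullet> a)" by (simp add: e_def cdef inner_vec2 algebra_simps)
  then have "a \<bullet> e = c" using a by (simp add: dot_square_norm)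
  then have ch: "c \<le> h" using x(2)[OF a(1)] by (simp add: h_def)
  have "norm x \<le> 1" using x K by auto
  then have h1: "h \<le> 1" using norm_cauchy_schwarz[of x e] ne by (simp add: h_def)
  have c: "1 / 2 \<le> c" unfolding cdef by (rule cos_pi_over_ge_half[OF n])
  have "cos (pi / real n) < cos 0" using n by (intro cos_monotone_0_pi) (auto simp: field_simps)
  then have c1: "c < 1" by (simp add: cdef)
  have "(real n)\<^sup>2 * (s\<^sup>2 + (1 - c / h) * (1 - c * h) / 4) \<le> area K * area (polar K)"
    using area_product_bound[OF n sdef cdef K a x(1)] x(2) unfolding h_def e_def by blast
  then show ?thesis using that[of h] c c1 ch h1 x(2) by (simp add: h_def e_def)
qed

text \<open>
  By symmetry the height bound for one sector holds for all of them, and the polygon is the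
  intersection of the corresponding half-planes.
\<close>
lemma sandwich_ngon:
  fixes K :: "(real^2) set"
  assumes n: "n \<ge> 3" and K: "compact K" "convex K" "rotation (2 * pi / real n) ` K = K" "K \<subseteq> cball 0 1"
    and a: "a \<in> K" "norm a = 1" and \<epsilon>: "0 \<le> \<epsilon>"
    and le: "area K * area (polar K) \<le> (1 + \<epsilon>) * ((real n)\<^sup>2 * (sin (pi / real n))\<^sup>2)"
    and v: "v \<in> K"
  shows "(1 / (1 + 12 * \<epsilon>)) *\<^sub>R v \<in> ngon n a"
proof (rule halfplanes_subset_ngon[OF n a(2)])
  fix k
  let ?\<theta> = "2 * pi / real n"
  define s c e where "s = sin (pi / real n)" and "c = cos (pi / real n)" and "e = rotation (pi / real n) a"
  obtain h where h: "1 / 2 \<le> c" "c < 1" "c \<le> h" "h \<le> 1" "\<And>v. v \<in> K \<Longrightarrow> v \<bullet> e \<le> h"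
    "(real n)\<^sup>2 * (s\<^sup>2 + (1 - c / h) * (1 - c * h) / 4) \<le> area K * area (polar K)"
    unfolding e_def using sector_height_product_bound[OF n K a s_def c_def] by metis
  have sc: "s\<^sup>2 + c\<^sup>2 = 1" by (simp add: s_def c_def)
  have "(real n)\<^sup>2 * (s\<^sup>2 + (1 - c / h) * (1 - c * h) / 4) \<le> area K * area (polar K)"
    by (rule h(6))
  also have "\<dots> \<le> (real n)\<^sup>2 * ((1 + \<epsilon>) * s\<^sup>2)"
    using le by (simp add: s_def mult.left_commute)
  finally have "(real n)\<^sup>2 * (s\<^sup>2 + (1 - c / h) * (1 - c * h) / 4) \<le> (real n)\<^sup>2 * ((1 + \<epsilon>) * s\<^sup>2)" .
  then have "s\<^sup>2 + (1 - c / h) * (1 - c * h) / 4 \<le> (1 + \<epsilon>) * s\<^sup>2"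
    using n by (simp add: mult_le_cancel_left)
  then have hc: "h \<le> (1 + 12 * \<epsilon>) * c" by (rule height_bound_algebra[OF h(1,2) sc h(3,4) \<epsilon>])
  have "rotation ((2 * real k + 1) * (pi / real n)) a = rotation (real k * ?\<theta>) e"
  proof -
    have "(2 * real k + 1) * (pi / real n) = real k * ?\<theta> + pi / real n" by (simp add: algebra_simps)
    then show ?thesis by (simp add: e_def rotation_rotation)
  qed
  then have "v \<bullet> rotation ((2 * real k + 1) * (pi / real n)) a = rotation (real k * (- ?\<theta>)) v \<bullet> e"
    by (simp add: inner_rotation_left)
  also have "\<dots> \<le> h"
    using h(5) invariant_rotation_iterate[OF invariant_rotation_uminus[OF K(3)] v] by blast
  finally have "v \<bullet> rotation ((2 * real k + 1) * (pi / real n)) a \<le> (1 + 12 * \<epsilon>) * c" using hc by simp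
  then show "((1 / (1 + 12 * \<epsilon>)) *\<^sub>R v) \<bullet> rotation ((2 * real k + 1) * (pi / real n)) a \<le> cos (pi / real n)"
    using \<epsilon> by (simp add: c_def pos_divide_le_eq mult.commute)
qed

lemma area_ngon_lower_bound:
  fixes K :: "(real^2) set"
  assumes n: "n \<ge> 3" and K: "compact K" "convex K" "rotation (2 * pi / real n) ` K = K"
    and a: "a \<in> K" "norm a = 1"
  shows "real n * sin (pi / real n) * cos (pi / real n) \<le> area K"
proof -
  let ?\<theta> = "2 * pi / real n"
  have \<theta>: "?\<theta> = 2 * (pi / real n)" by simp
  have "0 < ?\<theta>" "?\<theta> < pi" using n by (simp_all add: field_simps)
  then have s0: "0 < sin ?\<theta>" by (rule sin_gt_zero)
  have d: "det2 a (rotation ?\<theta> a) = sin ?\<theta>" using det2_rotation_self[of 0 a ?\<theta>] a by simp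
  have a0: "a \<noteq> 0" using a by auto
  have "0 \<in> K" using ngon_subset[OF K(2,3) a(1)] zero_in_ngon[of n a] n by auto
  then have "real n * ((det2 a a + det2 a a + det2 a (rotation ?\<theta> a)) / 2) \<le> measure lebesgue K"
    using s0 d a by (intro fan_area[OF n refl lmeasurable_compact[OF K(1)] K(3,2) _ a(1) a(1) a(1) a0 refl]) auto
  then have "real n * (sin ?\<theta> / 2) \<le> area K" by (simp add: d area_def)
  then show ?thesis unfolding \<theta> sin_double by (simp add: mult.assoc)
qed

text \<open>
  The excess of \<open>area (polar ((+) p ` K))\<close> over \<open>area (polar K)\<close> is quadratic in \<open>norm p\<close>, while the
  product of the areas about the centre of symmetry already reaches \<open>n\<^sup>2 * s\<^sup>2\<close>; hence that excess is
  paid for by \<open>\<epsilon>\<close> alone.  The constant comes from \<open>area K \<ge> n * s / 2\<close> and \<open>n * s \<le> pi\<close>.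
\<close>
lemma centre_stability:
  fixes K :: "(real^2) set"
  assumes n: "n \<ge> 3" and K: "compact K" "convex K" "rotation (2 * pi / real n) ` K = K" "K \<subseteq> cball 0 1"
    and a: "a \<in> K" "norm a = 1" and p: "- p \<in> interior K"
    and le: "area K * area (polar ((+) p ` K)) \<le> (1 + \<epsilon>) * ((real n)\<^sup>2 * (sin (pi / real n))\<^sup>2)"
  shows "area K * area (polar K) \<le> (1 + \<epsilon>) * ((real n)\<^sup>2 * (sin (pi / real n))\<^sup>2)"
    and "(norm p)\<^sup>2 \<le> 128 * \<epsilon>"
proof -
  define s c where "s = sin (pi / real n)" and "c = cos (pi / real n)"
  have ball: "cball 0 (1/2) \<subseteq> K"
    using half_disc_subset_ngon[OF n a(2)] ngon_subset[OF K(2,3) a(1)] by blast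
  have santalo: "area (polar K) + pi / 64 * (norm p)\<^sup>2 \<le> area (polar ((+) p ` K))"
    using n by (intro santalo_stability[OF _ K(3,4) ball p]) simp
  have A0: "0 \<le> area K" by (simp add: area_def)
  have *: "area K * (area (polar K) + pi / 64 * (norm p)\<^sup>2) \<le> (1 + \<epsilon>) * ((real n)\<^sup>2 * s\<^sup>2)"
    using mult_left_mono[OF santalo A0] le by (simp add: s_def)
  moreover have "0 \<le> area K * (pi / 64 * (norm p)\<^sup>2)" using A0 by simp
  ultimately show "area K * area (polar K) \<le> (1 + \<epsilon>) * ((real n)\<^sup>2 * (sin (pi / real n))\<^sup>2)"
    by (simp add: distrib_left s_def)
  obtain h where h: "1 / 2 \<le> c" "c < 1" "c \<le> h" "h \<le> 1"
    "(real n)\<^sup>2 * (s\<^sup>2 + (1 - c / h) * (1 - c * h) / 4) \<le> area K * area (polar K)"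
    using sector_height_product_bound[OF n K a s_def c_def] by metis
  have "0 < pi / real n" "pi / real n < pi" using n by (simp_all add: field_simps)
  then have s0: "0 < s" unfolding s_def by (intro sin_gt_zero)
  have hp: "0 < h" using h by linarith
  have "c * h \<le> 1 * 1" using h by (intro mult_mono) auto
  then have "0 \<le> (1 - c / h) * (1 - c * h)" using h(3) hp by simp
  then have "(real n)\<^sup>2 * s\<^sup>2 \<le> (real n)\<^sup>2 * (s\<^sup>2 + (1 - c / h) * (1 - c * h) / 4)"
    by (intro mult_left_mono) auto
  also note h(5)
  finally have "area K * (pi / 64 * (norm p)\<^sup>2) \<le> \<epsilon> * ((real n)\<^sup>2 * s\<^sup>2)"
    using * by (simp add: algebra_simps)
  moreover have "(real n * s * (1 / 2)) * (pi / 64 * (norm p)\<^sup>2) \<le> area K * (pi / 64 * (norm p)\<^sup>2)"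
  proof (rule mult_right_mono)
    have "real n * s * (1 / 2) \<le> real n * s * c" using h(1) s0 by (intro mult_left_mono) auto
    also have "\<dots> \<le> area K" unfolding s_def c_def by (rule area_ngon_lower_bound[OF n K(1-3) a])
    finally show "real n * s * (1 / 2) \<le> area K" .
  qed simp
  moreover have "(real n * s * (1 / 2)) * (pi / 64 * (norm p)\<^sup>2) = (real n * s) * (pi / 128 * (norm p)\<^sup>2)"
    "\<epsilon> * ((real n)\<^sup>2 * s\<^sup>2) = (real n * s) * (\<epsilon> * (real n * s))"
    by (simp_all add: power2_eq_square)
  ultimately have "(real n * s) * (pi / 128 * (norm p)\<^sup>2) \<le> (real n * s) * (\<epsilon> * (real n * s))"
    by linarith
  then have 1: "pi / 128 * (norm p)\<^sup>2 \<le> \<epsilon> * (real n * s)" using n s0 by (simp add: mult_le_cancel_left)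
  moreover have "0 \<le> pi / 128 * (norm p)\<^sup>2" by simp
  ultimately have "0 \<le> \<epsilon> * (real n * s)" by linarith
  moreover have "0 < real n * s" using n s0 by simp
  ultimately have "0 \<le> \<epsilon>" by (auto simp: zero_le_mult_iff)
  moreover have "real n * s \<le> pi"
  proof -
    have "real n * s \<le> real n * (pi / real n)"
      unfolding s_def using n by (intro mult_left_mono sin_x_le_x) auto
    then show ?thesis using n by simp
  qed
  ultimately have "pi / 128 * (norm p)\<^sup>2 \<le> \<epsilon> * pi" using 1 by (meson mult_left_mono order_trans)
  then have "pi * (norm p)\<^sup>2 \<le> pi * (128 * \<epsilon>)" by simp
  then show "(norm p)\<^sup>2 \<le> 128 * \<epsilon>" using pi_gt_zero by (simp only: mult_le_cancel_left_pos)
qed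

text \<open>
  The centre of symmetry is moved to the origin and the largest norm of a point is scaled to one.
  The scaling leaves the area product unchanged, the translation does not: it survives as the
  displacement \<open>p / \<rho>\<close> of the centre of polarity.
\<close>
lemma normal_form:
  fixes K :: "(real^2) set"
  assumes K: "convex_body K" "rotationally_symmetric n K" "0 \<in> interior K"
  obtains p \<rho> a K1 where "0 < \<rho>" "compact K1" "convex K1" "rotation (2 * pi / real n) ` K1 = K1"
    "K1 \<subseteq> cball 0 1" "a \<in> K1" "norm a = 1" "K = (\<lambda>v. p + \<rho> *\<^sub>R v) ` K1"
    "- ((1 / \<rho>) *\<^sub>R p) \<in> interior K1"
    "area K1 * area (polar ((+) ((1 / \<rho>) *\<^sub>R p) ` K1)) = area K * area (polar K)"
proof -
  let ?\<theta> = "2 * pi / real n"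
  obtain p where p: "(\<lambda>v. p + rotation ?\<theta> (v - p)) ` K = K"
    using K(2) by (auto simp: rotationally_symmetric_def)
  have cK: "compact K" "convex K" using K(1) by (auto simp: convex_body_def)
  have neK: "K \<noteq> {}" using K(3) interior_subset by blast
  have "continuous_on K (\<lambda>v. norm (v - p))" by (intro continuous_intros)
  then obtain b where b: "b \<in> K" "\<And>v. v \<in> K \<Longrightarrow> norm (v - p) \<le> norm (b - p)"
    using continuous_attains_sup[OF cK(1) neK] by blast
  define \<rho> where "\<rho> = norm (b - p)"
  have \<rho>: "0 < \<rho>"
  proof (rule ccontr)
    assume "\<not> 0 < \<rho>"
    then have "K \<subseteq> {p}" using b(2) by (fastforce simp: \<rho>_def)
    then have "interior K \<subseteq> interior {p}" by (rule interior_mono)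
    then show False using K(3) by simp
  qed
  define K1 where "K1 = (\<lambda>v. (1 / \<rho>) *\<^sub>R (v - p)) ` K"
  have K1_alt: "K1 = (\<lambda>v. - (1 / \<rho>) *\<^sub>R p + (1 / \<rho>) *\<^sub>R v) ` K"
    unfolding K1_def by (intro image_cong) (auto simp: scaleR_diff_right)
  have KK1: "K = (\<lambda>v. p + \<rho> *\<^sub>R v) ` K1"
    using \<rho> by (simp add: K1_def image_image)
  have 1: "compact K1" "convex K1" unfolding K1_alt using cK by (simp_all only: compact_affinity convex_affinity)
  have 2: "rotation ?\<theta> ` K1 = K1"
  proof -
    have "rotation ?\<theta> ` K1 = (\<lambda>v. (1 / \<rho>) *\<^sub>R (v - p)) ` ((\<lambda>v. p + rotation ?\<theta> (v - p)) ` K)"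
      by (simp add: K1_def image_image)
    then show ?thesis unfolding p K1_def[symmetric] .
  qed
  have 3: "K1 \<subseteq> cball 0 1" using b \<rho> by (auto simp: K1_def \<rho>_def)
  have 4: "(1 / \<rho>) *\<^sub>R (b - p) \<in> K1" "norm ((1 / \<rho>) *\<^sub>R (b - p)) = 1"
    using b \<rho> by (auto simp: K1_def \<rho>_def)
  let ?U = "(+) ((1 / \<rho>) *\<^sub>R p) ` K1"
  have KU: "K = (*\<^sub>R) \<rho> ` ?U" using \<rho> by (simp add: KK1 image_image scaleR_add_right)
  have "interior K = (*\<^sub>R) \<rho> ` interior ?U"
    unfolding KU using \<rho> by (intro interior_injective_linear_image) (auto simp: linear_scale_self linear_scaleR inj_on_def)
  then have iU: "0 \<in> interior ?U" using K(3) \<rho> by auto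
  then have 5: "- ((1 / \<rho>) *\<^sub>R p) \<in> interior K1"
    unfolding interior_translation by (metis add.inverse_unique imageE)
  have "area ?U = area K1" by (simp add: area_def measure_translation)
  moreover have "compact ?U" using 1 by (simp add: compact_translation)
  ultimately have 6: "area K1 * area (polar ?U) = area K * area (polar K)"
    using scale_area_product[OF \<rho> _ iU] unfolding KU[symmetric] by simp
  show ?thesis using that[OF \<rho> 1 2 3 4 KK1 5 6] .
qed

section \<open>Distance from a regular polygon\<close>

text \<open>
  The isometry \<open>U\<close> takes the positively oriented frame with first vector \<open>a\<close> to the given
  orthonormal basis.
\<close>
lemma regular_polygon_as_ngon_image:
  assumes n: "n > 0" and R: "regular_polygon_at (\<bullet>) n c R" and a: "norm a = 1"
  obtains r U where "0 < r" "orthogonal_transformation U" "R = (\<lambda>v. c + r *\<^sub>R U v) ` ngon n a"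
    "rotation (2 * pi / real n) ` U ` ngon n a = U ` ngon n a"
proof -
  let ?\<theta> = "2 * pi / real n"
  obtain r e1 e2 where r: "0 < r" and e: "e1 \<bullet> e1 = 1" "e2 \<bullet> e2 = 1" "e1 \<bullet> e2 = 0"
    and Rdef: "R = convex hull {c + r *\<^sub>R (cos (2 * pi * real k / real n) *\<^sub>R e1
                                  + sin (2 * pi * real k / real n) *\<^sub>R e2) | k. k < n}"
    using R by (auto simp: regular_polygon_at_def)
  define U where "U = (\<lambda>v. (v \<bullet> a) *\<^sub>R e1 + det2 a v *\<^sub>R e2)"
  have aa: "a \<bullet> a = 1" using a by (simp add: dot_square_norm)
  have lin: "linear U"
    by (rule linearI) (simp_all add: U_def inner_add_left algebra_simps)
  have U: "orthogonal_transformation U"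
    unfolding orthogonal_transformation_def
  proof (intro conjI allI)
    fix v w
    have "U v \<bullet> U w = (v \<bullet> a) * (w \<bullet> a) + det2 a v * det2 a w"
      using e by (simp add: U_def inner_add_left inner_add_right inner_commute[of e2 e1])
    also have "\<dots> = (v \<bullet> w) * (a \<bullet> a)" unfolding det2_def inner_vec2 by algebra
    finally show "U v \<bullet> U w = v \<bullet> w" using aa by simp
  qed (rule lin)
  have Ua: "U (rotation t a) = cos t *\<^sub>R e1 + sin t *\<^sub>R e2" for t
  proof -
    have "rotation t a \<bullet> a = cos t * (a \<bullet> a)" by (simp add: inner_vec2 algebra_simps)
    moreover have "det2 a (rotation t a) = sin t" using det2_rotation_self[of 0 a t] a by simp
    ultimately show ?thesis by (simp add: U_def aa)
  qed
  have "{c + r *\<^sub>R (cos (2 * pi * real k / real n) *\<^sub>R e1 + sin (2 * pi * real k / real n) *\<^sub>R e2) | k. k < n}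
      = (\<lambda>x. c + r *\<^sub>R x) ` U ` {rotation (2 * pi * real k / real n) a | k. k < n}"
    by (auto simp: Ua[symmetric])
  then have "R = (\<lambda>x. c + r *\<^sub>R x) ` U ` ngon n a"
    by (simp only: Rdef ngon_def convex_hull_affinity convex_hull_linear_image[OF lin])
  then have RU: "R = (\<lambda>v. c + r *\<^sub>R U v) ` ngon n a" by (simp add: image_image)
  \<comment> \<open>The basis may be oriented either way, so \<open>U\<close> either preserves or reverses angles.\<close>
  define \<sigma> where "\<sigma> = det2 e1 e2"
  have "\<sigma>\<^sup>2 + (e1 \<bullet> e2)\<^sup>2 = (e1 \<bullet> e1) * (e2 \<bullet> e2)"
    unfolding \<sigma>_def det2_def inner_vec2 by algebra
  then have "\<sigma>\<^sup>2 = 1" using e by simp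
  then have \<sigma>: "\<sigma> = 1 \<or> \<sigma> = - 1" by (simp add: power2_eq_1_iff)
  have e2: "e2 $ 1 = - \<sigma> * e1 $ 2" "e2 $ 2 = \<sigma> * e1 $ 1"
  proof -
    have "- \<sigma> * e1 $ 2 = (e1 \<bullet> e1) * e2 $ 1 - (e1 \<bullet> e2) * e1 $ 1"
      "\<sigma> * e1 $ 1 = (e1 \<bullet> e1) * e2 $ 2 - (e1 \<bullet> e2) * e1 $ 2"
      unfolding \<sigma>_def det2_def inner_vec2 by algebra+
    then show "e2 $ 1 = - \<sigma> * e1 $ 2" "e2 $ 2 = \<sigma> * e1 $ 1" using e by simp_all
  qed
  have rotU: "rotation ?\<theta> (U v) = U (rotation (\<sigma> * ?\<theta>) v)" for v
    using \<sigma> by (auto simp: U_def vec2_eq_iff e2 det2_def inner_vec2 algebra_simps)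
  have "rotation (\<sigma> * ?\<theta>) ` ngon n a = ngon n a"
    by (rule disjE[OF \<sigma>]) (simp_all add: rotation_ngon[OF n] invariant_rotation_uminus[OF rotation_ngon[OF n]])
  moreover have "rotation ?\<theta> ` U ` ngon n a = U ` rotation (\<sigma> * ?\<theta>) ` ngon n a"
    by (simp add: image_image rotU)
  ultimately have "rotation ?\<theta> ` U ` ngon n a = U ` ngon n a" by simp
  then show ?thesis by (rule that[OF r U RU])
qed

lemma BM_sim_dist_le:
  assumes "0 < l1" "0 < l2" "similarity A" "(\<lambda>y. l1 *\<^sub>R y) ` A ` K \<subseteq> L" "L \<subseteq> (\<lambda>y. l2 *\<^sub>R y + x) ` A ` K"
  shows "BM_sim_dist K L \<le> l2 / l1"
  unfolding BM_sim_dist_def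
proof (rule cInf_lower)
  show "bdd_below {l2 / l1 | l1 l2. 0 < l1 \<and> 0 < l2 \<and>
     (\<exists>A x. similarity A \<and> (\<lambda>y. l1 *\<^sub>R y) ` A ` K \<subseteq> L \<and> L \<subseteq> (\<lambda>y. l2 *\<^sub>R y + x) ` A ` K)}"
    by (rule bdd_belowI[of _ 0]) auto
  show "l2 / l1 \<in> {l2 / l1 | l1 l2. 0 < l1 \<and> 0 < l2 \<and>
     (\<exists>A x. similarity A \<and> (\<lambda>y. l1 *\<^sub>R y) ` A ` K \<subseteq> L \<and> L \<subseteq> (\<lambda>y. l2 *\<^sub>R y + x) ` A ` K)}"
    by (intro CollectI exI[of _ l1] exI[of _ l2] exI[of _ A] exI[of _ x] conjI refl assms)
qed

text \<open>
  The similarity takes \<open>p\<close> to the centre of \<open>R\<close> and scales \<open>K1\<close> so that its bound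
  by \<open>m\<close> times the inscribed polygon makes it fit into \<open>R\<close>.
\<close>
lemma BM_sim_dist_sandwich:
  assumes n: "n > 0" and R: "regular_polygon (\<bullet>) n R" and a: "norm a = 1"
    and K: "K = (\<lambda>v. p + \<rho> *\<^sub>R v) ` K1" "0 < \<rho>" and m: "0 < m"
    and sub: "ngon n a \<subseteq> K1" "\<And>v. v \<in> K1 \<Longrightarrow> (1 / m) *\<^sub>R v \<in> ngon n a"
  shows "BM_sim_dist K R \<le> m"
proof -
  obtain c where "regular_polygon_at (\<bullet>) n c R" using R by (auto simp: regular_polygon_def)
  then obtain r U where rU: "0 < r" "orthogonal_transformation U" "R = (\<lambda>v. c + r *\<^sub>R U v) ` ngon n a"
    using regular_polygon_as_ngon_image[OF n _ a] by metis
  have lin: "linear U" using rU orthogonal_transformation_linear by blast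
  define A where "A = (\<lambda>x. c + (r / (m * \<rho>)) *\<^sub>R U (x - p))"
  have "dist (A x) (A y) = r / (m * \<rho>) * dist x y" for x y
  proof -
    have "A x - A y = (r / (m * \<rho>)) *\<^sub>R U (x - y)"
      by (simp add: A_def linear_diff[OF lin] algebra_simps)
    then show ?thesis
      using rU m K(2) by (simp add: dist_norm orthogonal_transformation_norm)
  qed
  then have sim: "similarity A" unfolding similarity_def using rU m K(2) by (intro exI[of _ "r / (m * \<rho>)"]) simp
  have AK: "A (p + \<rho> *\<^sub>R v) = c + (r / m) *\<^sub>R U v" for v
    using K(2) m by (simp add: A_def linear_scale[OF lin])
  have "(\<lambda>y. 1 *\<^sub>R y) ` A ` K \<subseteq> R"
  proof -
    have "A (p + \<rho> *\<^sub>R v) \<in> R" if "v \<in> K1" for v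
    proof -
      have "A (p + \<rho> *\<^sub>R v) = c + r *\<^sub>R U ((1 / m) *\<^sub>R v)" by (simp add: AK linear_scale[OF lin])
      then show ?thesis unfolding rU(3) using sub(2)[OF that] by blast
    qed
    then show ?thesis by (auto simp: K(1))
  qed
  moreover have "R \<subseteq> (\<lambda>y. m *\<^sub>R y + (c - m *\<^sub>R c)) ` A ` K"
  proof
    fix y assume "y \<in> R"
    then obtain v where v: "v \<in> ngon n a" "y = c + r *\<^sub>R U v" using rU(3) by blast
    then have "y = m *\<^sub>R A (p + \<rho> *\<^sub>R v) + (c - m *\<^sub>R c)"
      using m by (simp add: AK scaleR_add_right)
    then show "y \<in> (\<lambda>y. m *\<^sub>R y + (c - m *\<^sub>R c)) ` A ` K" using v(1) sub(1) K(1) by blast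
  qed
  ultimately have "BM_sim_dist K R \<le> m / 1" using sim m by (intro BM_sim_dist_le) auto
  then show ?thesis by simp
qed

section \<open>Distance of the centre from the origin\<close>

text \<open>
  If \<open>d + S \<subseteq> C\<close>, then also \<open>d' + S \<subseteq> C\<close> for every rotated image \<open>d'\<close> of \<open>d\<close>, and the mean of these
  images is zero.
\<close>
lemma translate_removal_by_averaging:
  fixes S C :: "(real^2) set"
  assumes n: "n \<ge> 2" and S: "rotation (2 * pi / real n) ` S = S"
    and C: "rotation (2 * pi / real n) ` C = C" "convex C"
    and sub: "\<And>x. x \<in> S \<Longrightarrow> d + x \<in> C" and x: "x \<in> S"
  shows "x \<in> C"
proof -
  let ?\<theta> = "2 * pi / real n"
  have mem: "rotation (real k * ?\<theta>) d + x \<in> C" for k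
  proof -
    have "rotation (real k * (- ?\<theta>)) x \<in> S"
      by (rule invariant_rotation_iterate[OF invariant_rotation_uminus[OF S] x])
    then have "rotation (real k * ?\<theta>) (d + rotation (real k * (- ?\<theta>)) x) \<in> C"
      by (intro invariant_rotation_iterate[OF C(1)] sub)
    then show ?thesis
      by (simp add: linear_add[OF linear_rotation] rotation_rotation)
  qed
  have "(\<Sum>k<n. (1 / real n) *\<^sub>R (rotation (real k * ?\<theta>) d + x)) \<in> C"
    using n by (intro convex_sum C(2) mem) auto
  moreover have "(\<Sum>k<n. (1 / real n) *\<^sub>R (rotation (real k * ?\<theta>) d + x)) = x"
    using n sum_rotations_eq_0[OF n, of d]
    by (simp add: scaleR_sum_right[symmetric] sum.distrib sum_constant_scaleR del: sum_constant)
  ultimately show ?thesis by simp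
qed

text \<open>
  If \<open>m1 * Q + w \<subseteq> m2 * Q\<close>, comparing the maxima of \<open>v \<bullet> w\<close> on the two sets gives
  \<open>(norm w)\<^sup>2 \<le> (m2 - m1) * (r * norm w)\<close>.
\<close>
lemma homothetic_inclusion_shift:
  fixes Q :: "(real^2) set"
  assumes Q: "compact Q" "q0 \<in> Q" "\<And>q. q \<in> Q \<Longrightarrow> norm q \<le> r" and m: "0 \<le> m2" "m1 \<le> m2"
    and sub: "\<And>q. q \<in> Q \<Longrightarrow> \<exists>q'\<in>Q. m1 *\<^sub>R q + w = m2 *\<^sub>R q'"
  shows "norm w \<le> (m2 - m1) * r"
proof (cases "w = 0")
  case True
  have "0 \<le> r" using Q(3)[OF Q(2)] norm_ge_zero order_trans by blast
  then show ?thesis using True m by simp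
next
  case False
  have "continuous_on Q (\<lambda>v. v \<bullet> w)" by (intro continuous_intros)
  then obtain q where q: "q \<in> Q" "\<And>v. v \<in> Q \<Longrightarrow> v \<bullet> w \<le> q \<bullet> w"
    using continuous_attains_sup[OF Q(1)] Q(2) by blast
  obtain q' where q': "q' \<in> Q" "m1 *\<^sub>R q + w = m2 *\<^sub>R q'" using sub[OF q(1)] by blast
  have "m1 * (q \<bullet> w) + w \<bullet> w = m2 * (q' \<bullet> w)"
    using arg_cong[OF q'(2), of "\<lambda>v. v \<bullet> w"] by (simp add: inner_add_left)
  also have "\<dots> \<le> m2 * (q \<bullet> w)" using q(2)[OF q'(1)] m by (intro mult_left_mono) auto
  finally have "norm w * norm w \<le> (m2 - m1) * (q \<bullet> w)"
    by (simp add: dot_square_norm power2_eq_square algebra_simps)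
  also have "\<dots> \<le> (m2 - m1) * (r * norm w)"
    using m norm_cauchy_schwarz[of q w] mult_right_mono[OF Q(3)[OF q(1)] norm_ge_zero[of w]]
    by (intro mult_left_mono) auto
  finally have "norm w * norm w \<le> ((m2 - m1) * r) * norm w" by (simp add: mult.assoc)
  then show ?thesis using False by simp
qed

text \<open>
  The polygon contains two points that differ by the vector of standard norm \<open>r\<close> in direction \<open>v\<close>;
  their distance for \<open>B\<close> is at most the diameter.
\<close>
lemma norm_wrt_le_of_disc:
  assumes B: "inner_product B" and P: "bounded P" "cball y (r / 2) \<subseteq> P" and r: "0 < r"
    and diam: "diameter_wrt B P = 1"
  shows "norm_wrt B v \<le> norm v / r"
proof (cases "v = 0")
  case True
  then show ?thesis using B by (simp add: inner_product_def norm_wrt_def bilinear_lzero)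
next
  case False
  have bil: "bilinear B" using B by (simp add: inner_product_def)
  obtain M where M: "\<And>x y. norm (B x y) \<le> M * norm x * norm y" using bilinear_bounded[OF bil] by blast
  obtain b where b: "\<And>x. x \<in> P \<Longrightarrow> norm x \<le> b" using P(1) by (auto simp: bounded_iff)
  have scale: "norm_wrt B (k *\<^sub>R x) = \<bar>k\<bar> * norm_wrt B x" for k x
    by (simp add: norm_wrt_def bilinear_lmul[OF bil] bilinear_rmul[OF bil] real_sqrt_mult mult.assoc[symmetric]
        real_sqrt_abs2)
  have bdd: "bdd_above {norm_wrt B (x - y) | x y. x \<in> P \<and> y \<in> P}"
  proof (rule bdd_aboveI)
    fix z assume "z \<in> {norm_wrt B (x - y) | x y. x \<in> P \<and> y \<in> P}"
    then obtain x y where xy: "x \<in> P" "y \<in> P" "z = norm_wrt B (x - y)" by blast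
    have "B (x - y) (x - y) \<le> M * (norm (x - y))\<^sup>2"
      using M[of "x - y" "x - y"] by (simp add: power2_eq_square mult.assoc)
    also have "\<dots> \<le> \<bar>M\<bar> * (2 * b)\<^sup>2"
      using norm_triangle_ineq4[of x y] b[OF xy(1)] b[OF xy(2)] by (intro mult_mono power_mono) auto
    finally show "z \<le> sqrt (\<bar>M\<bar> * (2 * b)\<^sup>2)" by (simp add: xy(3) norm_wrt_def)
  qed
  define u where "u = (r / 2 / norm v) *\<^sub>R v"
  have "norm u = r / 2" using False r by (simp add: u_def)
  then have "y + u \<in> P" "y - u \<in> P" using P(2) by (auto simp: subset_iff dist_norm)
  then have "norm_wrt B ((y + u) - (y - u)) \<le> diameter_wrt B P"
    unfolding diameter_wrt_def by (intro cSup_upper bdd) blast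
  moreover have "(y + u) - (y - u) = (r / norm v) *\<^sub>R v"
    by (simp add: u_def scaleR_add_left[symmetric])
  ultimately have "r / norm v * norm_wrt B v \<le> 1" using r scale diam by simp
  then show ?thesis using False r by (simp add: field_simps)
qed

text \<open>
  Here \<open>N \<le> 12 * sqrt \<epsilon>\<close> and \<open>\<epsilon> \<le> sqrt \<epsilon>\<close>, which gives \<open>42 * sqrt \<epsilon>\<close>.
\<close>
lemma sqrt_error_bound:
  fixes \<epsilon> :: real
  assumes "0 < \<epsilon>" "\<epsilon> \<le> 1" "N\<^sup>2 \<le> 128 * \<epsilon>"
  shows "2 * N + 18 * \<epsilon> \<le> 263 * sqrt \<epsilon>"
proof -
  have "\<epsilon> * \<epsilon> \<le> \<epsilon> * 1" using assms by (intro mult_left_mono) auto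
  then have "\<epsilon> \<le> sqrt \<epsilon>" by (intro real_le_rsqrt) (simp add: power2_eq_square)
  moreover have "N\<^sup>2 \<le> (12 * sqrt \<epsilon>)\<^sup>2" using assms by (simp add: power_mult_distrib)
  then have "N \<le> 12 * sqrt \<epsilon>" by (rule power2_le_imp_le) (use assms(1) in simp)
  ultimately show ?thesis using assms by simp
qed

text \<open>
  Both given polygons have centres within \<open>(\<mu>2 - \<mu>1) * r \<le> 18 * \<epsilon> * r\<close> of the centre \<open>p\<close> of symmetry,
  where \<open>r\<close> is the circumradius of the polygon of mean size, and \<open>p\<close> is within \<open>2 * r * N\<close> of the
  origin with \<open>N\<^sup>2 \<le> 128 * \<epsilon>\<close>, because the largest norm \<open>\<rho>\<close> is at most the larger circumradius
  \<open>\<mu>2 * r \<le> 2 * r\<close>.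
\<close>
lemma centre_bound:
  fixes K :: "(real^2) set"
  assumes n: "n \<ge> 3" and K: "K = (\<lambda>v. p + \<rho> *\<^sub>R v) ` K1" "0 < \<rho>" "rotation (2 * pi / real n) ` K1 = K1" "convex K1"
    and a: "a \<in> K1" "norm a = 1" and p: "(norm ((1 / \<rho>) *\<^sub>R p))\<^sup>2 \<le> 128 * \<epsilon>"
    and \<epsilon>: "0 < \<epsilon>" "\<epsilon> \<le> 1" and l: "0 < l1" "0 < l2" "l2 / l1 \<le> 1 + 18 * \<epsilon>"
    and inc: "(\<lambda>y. l1 *\<^sub>R y + x) ` R \<subseteq> K" "K \<subseteq> (\<lambda>y. l2 *\<^sub>R y + x) ` R"
    and B: "inner_product B" "diameter_wrt B ((\<lambda>y. ((l1 + l2) / 2) *\<^sub>R y) ` R) = 1"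
    and c: "regular_polygon_at (\<bullet>) n c ((\<lambda>y. ((l1 + l2) / 2) *\<^sub>R y + x) ` R)"
  shows "norm_wrt B c \<le> 263 * sqrt \<epsilon>"
proof -
  let ?\<theta> = "2 * pi / real n"
  define l where "l = (l1 + l2) / 2"
  have l0: "0 < l" using l by (simp add: l_def)
  have n0: "n > 0" "n \<ge> 2" using n by auto
  obtain r U where rU: "0 < r" "orthogonal_transformation U"
      "(\<lambda>y. l *\<^sub>R y + x) ` R = (\<lambda>v. c + r *\<^sub>R U v) ` ngon n a" "rotation ?\<theta> ` U ` ngon n a = U ` ngon n a"
    using regular_polygon_as_ngon_image[OF n0(1) c a(2)] unfolding l_def by metis
  have lin: "linear U" using rU orthogonal_transformation_linear by blast
  have nU: "norm (U v) = norm v" for v using rU(2) orthogonal_transformation_norm by blast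
  define Q where "Q = (\<lambda>v. r *\<^sub>R U v) ` ngon n a"
  have lR: "(\<lambda>y. l *\<^sub>R y + x) ` R = (\<lambda>q. c + q) ` Q" by (simp add: rU(3) Q_def image_image)
  have Q_lin: "linear (\<lambda>v. r *\<^sub>R U v)" using lin by (rule linear_compose_scale_right)
  have Qcomp: "compact Q" unfolding Q_def using Q_lin
    by (intro compact_continuous_image linear_continuous_on ngon_compact) (simp add: linear_conv_bounded_linear)
  have Qconv: "convex Q" unfolding Q_def by (rule convex_linear_image[OF Q_lin ngon_convex])
  have Qrot: "rotation ?\<theta> ` Q = Q"
  proof -
    have "rotation ?\<theta> ` Q = (*\<^sub>R) r ` rotation ?\<theta> ` U ` ngon n a" by (simp add: Q_def image_image)
    then show ?thesis unfolding rU(4) by (simp add: Q_def image_image)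
  qed
  have "ngon n a \<subseteq> cball 0 1"
    unfolding ngon_def using a by (intro hull_minimal) auto
  then have Qle: "norm q \<le> r" if "q \<in> Q" for q
    using that rU(1) by (auto simp: Q_def nU mult_le_cancel_left2 subset_iff)
  define q0 where "q0 = r *\<^sub>R U a"
  have "a \<in> ngon n a" using rotation_in_ngon[OF n0(1), of 0 a] by simp
  then have q0: "q0 \<in> Q" "norm q0 = r" using rU(1) a by (auto simp: q0_def Q_def nU)
  have Qball: "cball 0 (r / 2) \<subseteq> Q"
  proof
    fix z :: "real^2" assume z: "z \<in> cball 0 (r / 2)"
    obtain v where v: "(1 / r) *\<^sub>R z = U v" using orthogonal_transformation_surj[OF rU(2)] by (metis surjD)
    have "norm v = norm ((1 / r) *\<^sub>R z)" by (simp only: v nU)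
    also have "\<dots> \<le> 1 / 2" using z rU(1) by (simp add: field_simps)
    finally have "v \<in> ngon n a" using half_disc_subset_ngon[OF n a(2)] by (simp add: subset_iff)
    moreover have "z = r *\<^sub>R U v" using rU(1) by (simp flip: v)
    ultimately show "z \<in> Q" by (auto simp: Q_def)
  qed
  \<comment> \<open>The sizes of the two given polygons relative to the one of mean size, and their centres:
    the midpoint of the centres is \<open>c\<close>.\<close>
  define \<mu>1 \<mu>2 where "\<mu>1 = l1 / l" and "\<mu>2 = l2 / l"
  have \<mu>: "0 < \<mu>1" "0 < \<mu>2" "\<mu>1 + \<mu>2 = 2"
    using l l0 by (simp_all add: \<mu>1_def \<mu>2_def add_divide_distrib[symmetric]) (simp add: l_def field_simps)
  define c1 c2 where "c1 = x + \<mu>1 *\<^sub>R (c - x)" and "c2 = x + \<mu>2 *\<^sub>R (c - x)"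
  have c12: "c1 + c2 = 2 *\<^sub>R c"
  proof -
    have "c1 + c2 = 2 *\<^sub>R x + (\<mu>1 + \<mu>2) *\<^sub>R (c - x)"
      by (simp add: c1_def c2_def scaleR_add_left scaleR_2)
    then show ?thesis by (simp add: \<mu>(3) algebra_simps)
  qed
  have transfer: "k *\<^sub>R y + x = x + (k / l) *\<^sub>R (c - x) + (k / l) *\<^sub>R q" if "l *\<^sub>R y + x = c + q" for k y q
  proof -
    have "k *\<^sub>R y = (k / l) *\<^sub>R (l *\<^sub>R y)" using l0 by simp
    also have "l *\<^sub>R y = (c - x) + q" using that by (simp add: algebra_simps)
    finally show ?thesis by (simp add: scaleR_add_right add_ac)
  qed
  have inK: "c1 + \<mu>1 *\<^sub>R q \<in> K" if "q \<in> Q" for q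
  proof -
    have "c + q \<in> (\<lambda>y. l *\<^sub>R y + x) ` R" using lR that by blast
    then obtain y where y: "c + q = l *\<^sub>R y + x" "y \<in> R" by (rule imageE)
    have "l1 *\<^sub>R y + x \<in> K" using inc(1) y(2) by blast
    also have "l1 *\<^sub>R y + x = c1 + \<mu>1 *\<^sub>R q" using transfer[OF y(1)[symmetric], of l1] by (simp only: c1_def \<mu>1_def)
    finally show ?thesis .
  qed
  have outK: "\<exists>q\<in>Q. z = c2 + \<mu>2 *\<^sub>R q" if "z \<in> K" for z
  proof -
    obtain y where y: "y \<in> R" "z = l2 *\<^sub>R y + x" using inc(2) \<open>z \<in> K\<close> by blast
    then have "l *\<^sub>R y + x \<in> (\<lambda>q. c + q) ` Q" using lR by blast
    then obtain q where q: "l *\<^sub>R y + x = c + q" "q \<in> Q" by (rule imageE)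
    then show ?thesis using transfer[OF q(1), of l2] y(2) by (auto simp: c2_def \<mu>2_def)
  qed
  define K0 where "K0 = (*\<^sub>R) \<rho> ` K1"
  have K0: "v \<in> K0 \<longleftrightarrow> p + v \<in> K" for v by (auto simp: K0_def K(1))
  have K0rot: "rotation ?\<theta> ` K0 = K0"
  proof -
    have "rotation ?\<theta> ` K0 = (*\<^sub>R) \<rho> ` rotation ?\<theta> ` K1" by (simp add: K0_def image_image)
    then show ?thesis by (simp add: K(3) K0_def)
  qed
  have K0conv: "convex K0" unfolding K0_def by (rule convex_scaling[OF K(4)])
  have scaled_rot: "rotation ?\<theta> ` (*\<^sub>R) m ` Q = (*\<^sub>R) m ` Q" for m
  proof -
    have "rotation ?\<theta> ` (*\<^sub>R) m ` Q = (*\<^sub>R) m ` rotation ?\<theta> ` Q" by (simp add: image_image)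
    then show ?thesis by (simp add: Qrot)
  qed
  have inner: "\<mu>1 *\<^sub>R q \<in> K0" if "q \<in> Q" for q
  proof (rule translate_removal_by_averaging[OF n0(2) scaled_rot[of \<mu>1] K0rot K0conv, where d = "c1 - p"])
    show "c1 - p + y \<in> K0" if "y \<in> (*\<^sub>R) \<mu>1 ` Q" for y
      using that inK by (auto simp: K0)
  qed (use that in blast)
  have outer: "\<exists>q\<in>Q. y = \<mu>2 *\<^sub>R q" if "y \<in> K0" for y
  proof -
    have "y \<in> (*\<^sub>R) \<mu>2 ` Q"
    proof (rule translate_removal_by_averaging[OF n0(2) K0rot scaled_rot[of \<mu>2], where d = "p - c2"])
      show "p - c2 + v \<in> (*\<^sub>R) \<mu>2 ` Q" if v: "v \<in> K0" for v
      proof -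
        obtain q where "q \<in> Q" "p + v = c2 + \<mu>2 *\<^sub>R q" using outK v K0 by blast
        then show ?thesis by (intro image_eqI[of _ _ q]) (simp_all add: algebra_simps)
      qed
    qed (use that in \<open>auto intro: convex_scaling Qconv\<close>)
    then show ?thesis by blast
  qed
  have \<mu>le: "\<mu>1 \<le> \<mu>2"
  proof -
    obtain q where q: "q \<in> Q" "\<mu>1 *\<^sub>R q0 = \<mu>2 *\<^sub>R q" using outer inner q0 by blast
    have "norm (\<mu>1 *\<^sub>R q0) = norm (\<mu>2 *\<^sub>R q)" by (simp only: q(2))
    then have "\<mu>1 * r = \<mu>2 * norm q" using \<mu>(1,2) q0(2) by simp
    also have "\<dots> \<le> \<mu>2 * r" using Qle[OF q(1)] \<mu> by simp
    finally show ?thesis using rU(1) by simp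
  qed
  have d1: "norm (c1 - p) \<le> (\<mu>2 - \<mu>1) * r"
  proof (rule homothetic_inclusion_shift[OF Qcomp q0(1) Qle _ \<mu>le])
    show "\<exists>q'\<in>Q. \<mu>1 *\<^sub>R q + (c1 - p) = \<mu>2 *\<^sub>R q'" if "q \<in> Q" for q
      using inK[OF that] by (intro outer) (simp add: K0 add.commute)
  qed (use \<mu> in auto)
  have d2: "norm (p - c2) \<le> (\<mu>2 - \<mu>1) * r"
  proof (rule homothetic_inclusion_shift[OF Qcomp q0(1) Qle _ \<mu>le])
    show "\<exists>q'\<in>Q. \<mu>1 *\<^sub>R q + (p - c2) = \<mu>2 *\<^sub>R q'" if "q \<in> Q" for q
    proof -
      have "p + \<mu>1 *\<^sub>R q \<in> K" using inner[OF that] K0 by blast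
      then obtain q' where "q' \<in> Q" "p + \<mu>1 *\<^sub>R q = c2 + \<mu>2 *\<^sub>R q'" using outK by blast
      then show ?thesis by (intro bexI[of _ q']) (simp_all add: algebra_simps)
    qed
  qed (use \<mu> in auto)
  have dc: "norm (c - p) \<le> (\<mu>2 - \<mu>1) * r"
  proof -
    have "2 *\<^sub>R (c - p) = (c1 - p) - (p - c2)"
      using c12 by (simp add: scaleR_diff_right scaleR_2 algebra_simps)
    then have "2 * norm (c - p) \<le> norm (c1 - p) + norm (p - c2)"
      using norm_triangle_ineq4[of "c1 - p" "p - c2"] by (metis norm_scaleR abs_numeral)
    then show ?thesis using d1 d2 by linarith
  qed
  have \<mu>diff: "\<mu>2 - \<mu>1 \<le> 18 * \<epsilon>"
  proof -
    have "\<mu>2 / \<mu>1 = l2 / l1" using l l0 by (simp add: \<mu>1_def \<mu>2_def)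
    then have "\<mu>2 / \<mu>1 \<le> 1 + 18 * \<epsilon>" using l(3) by simp
    then have "\<mu>2 \<le> (1 + 18 * \<epsilon>) * \<mu>1" using \<mu>(1) by (simp add: pos_divide_le_eq)
    then have "\<mu>2 - \<mu>1 \<le> 18 * \<epsilon> * \<mu>1" by (simp add: algebra_simps)
    also have "\<dots> \<le> 18 * \<epsilon> * 1" using \<mu> \<mu>le \<epsilon> by (intro mult_left_mono) auto
    finally show ?thesis by simp
  qed
  have \<rho>r: "\<rho> \<le> 2 * r"
  proof -
    obtain q where q: "q \<in> Q" "\<rho> *\<^sub>R a = \<mu>2 *\<^sub>R q" using outer a by (auto simp: K0_def)
    have "norm (\<rho> *\<^sub>R a) = norm (\<mu>2 *\<^sub>R q)" by (simp only: q(2))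
    then have "\<rho> = \<mu>2 * norm q" using \<mu>(2) a(2) K(2) by simp
    moreover have "\<mu>2 * norm q \<le> 2 * r"
      using Qle[OF q(1)] \<mu> norm_ge_zero[of q] by (intro mult_mono) linarith+
    ultimately show ?thesis by simp
  qed
  define N where "N = norm ((1 / \<rho>) *\<^sub>R p)"
  have "norm p = \<rho> * N" using K(2) by (simp add: N_def)
  also have "\<dots> \<le> 2 * r * N" using \<rho>r by (intro mult_right_mono) (auto simp: N_def)
  finally have np: "norm p \<le> 2 * r * N" .
  have "norm c \<le> norm (c - p) + norm p" using norm_triangle_ineq[of "c - p" p] by simp
  also have "\<dots> \<le> (\<mu>2 - \<mu>1) * r + 2 * r * N" using dc np by simp
  also have "\<dots> \<le> 18 * \<epsilon> * r + 2 * r * N" using \<mu>diff rU(1) by simp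
  also have "\<dots> = r * (2 * N + 18 * \<epsilon>)" by (simp add: algebra_simps)
  also have "\<dots> \<le> r * (263 * sqrt \<epsilon>)"
    using rU(1) sqrt_error_bound[OF \<epsilon>, of N] p by (intro mult_left_mono) (auto simp: N_def)
  finally have nc: "norm c / r \<le> 263 * sqrt \<epsilon>" using rU(1) by (simp add: pos_divide_le_eq mult.commute)
  have lR0: "(\<lambda>y. l *\<^sub>R y) ` R = (\<lambda>q. (c - x) + q) ` Q"
  proof -
    have "(\<lambda>y. l *\<^sub>R y) ` R = (\<lambda>z. z - x) ` (\<lambda>y. l *\<^sub>R y + x) ` R" by (simp add: image_image)
    also have "\<dots> = (\<lambda>q. (c - x) + q) ` Q" unfolding lR by (simp add: image_image algebra_simps)
    finally show ?thesis .
  qed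
  have "norm_wrt B c \<le> norm c / r"
  proof (rule norm_wrt_le_of_disc[OF B(1) _ _ rU(1)])
    show "bounded ((\<lambda>y. l *\<^sub>R y) ` R)"
      unfolding lR0 using Qcomp by (intro bounded_translation compact_imp_bounded)
    show "cball (c - x) (r / 2) \<subseteq> (\<lambda>y. l *\<^sub>R y) ` R"
    proof
      fix z assume "z \<in> cball (c - x) (r / 2)"
      then have "z - (c - x) \<in> Q" using Qball by (auto simp: dist_norm norm_minus_commute subset_iff)
      then show "z \<in> (\<lambda>y. l *\<^sub>R y) ` R" unfolding lR0 by (intro image_eqI[of _ _ "z - (c - x)"]) auto
    qed
    show "diameter_wrt B ((\<lambda>y. l *\<^sub>R y) ` R) = 1" using B(2) by (simp add: l_def)
  qed
  then show ?thesis using nc by linarith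
qed

theorem theorem5:
  fixes n :: nat and K :: "(real^2) set" and \<epsilon> :: real
  assumes "n \<ge> 3"
    and "convex_body K"
    and "rotationally_symmetric n K"
    and "0 \<in> interior K"
    and "\<epsilon> > 0"
    and "area K * area (polar K) \<le> (1 + \<epsilon>) * ((real n)\<^sup>2 * (sin (pi / real n))\<^sup>2)"
  shows "(\<forall>R. regular_polygon (\<bullet>) n R \<longrightarrow> BM_sim_dist K R \<le> 1 + 18 * \<epsilon>) \<and>
    (\<forall>(x :: real^2) (l1 :: real) (l2 :: real) R.
       l1 > 0 \<longrightarrow> l2 > 0 \<longrightarrow> regular_polygon (\<bullet>) n R \<longrightarrow>
       (\<lambda>y. l1 *\<^sub>R y + x) ` R \<subseteq> K \<longrightarrow> K \<subseteq> (\<lambda>y. l2 *\<^sub>R y + x) ` R \<longrightarrow>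
       l2 / l1 \<le> 1 + 18 * \<epsilon> \<longrightarrow> 1 + 18 * \<epsilon> < 1 / cos (pi / real n) \<longrightarrow> 1 / cos (pi / real n) \<le> 2 \<longrightarrow>
       (\<forall>B c. inner_product B \<longrightarrow>
          regular_polygon B n ((\<lambda>y. ((l1 + l2) / 2) *\<^sub>R y) ` R) \<longrightarrow>
          diameter_wrt B ((\<lambda>y. ((l1 + l2) / 2) *\<^sub>R y) ` R) = 1 \<longrightarrow>
          regular_polygon_at (\<bullet>) n c ((\<lambda>y. ((l1 + l2) / 2) *\<^sub>R y + x) ` R) \<longrightarrow>
          norm_wrt B c \<le> 263 * sqrt \<epsilon>))"
proof -
  obtain p \<rho> a K1 where nf: "0 < \<rho>" "compact K1" "convex K1" "rotation (2 * pi / real n) ` K1 = K1"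
    "K1 \<subseteq> cball 0 1" "a \<in> K1" "norm a = 1" "K = (\<lambda>v. p + \<rho> *\<^sub>R v) ` K1"
    "- ((1 / \<rho>) *\<^sub>R p) \<in> interior K1"
    "area K1 * area (polar ((+) ((1 / \<rho>) *\<^sub>R p) ` K1)) = area K * area (polar K)"
    using normal_form[OF assms(2-4)] by metis
  note centre = centre_stability[OF assms(1) nf(2-7,9) assms(6)[folded nf(10)]]
  have n0: "n > 0" using assms(1) by simp
  show ?thesis
  proof (intro conjI allI impI)
    fix R assume R: "regular_polygon (\<bullet>) n R"
    have "BM_sim_dist K R \<le> 1 + 12 * \<epsilon>"
      using assms(5) sandwich_ngon[OF assms(1) nf(2-7) _ centre(1)]
      by (intro BM_sim_dist_sandwich[OF n0 R nf(7,8,1) _ ngon_subset[OF nf(3,4,6)]]) auto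
    then show "BM_sim_dist K R \<le> 1 + 18 * \<epsilon>" using assms(5) by simp
  next
    fix x l1 l2 R B c
    assume "l1 > 0" "l2 > 0" "(\<lambda>y. l1 *\<^sub>R y + x) ` R \<subseteq> K" "K \<subseteq> (\<lambda>y. l2 *\<^sub>R y + x) ` R"
      "l2 / l1 \<le> 1 + 18 * \<epsilon>" "1 + 18 * \<epsilon> < 1 / cos (pi / real n)" "1 / cos (pi / real n) \<le> 2"
      "inner_product B" "diameter_wrt B ((\<lambda>y. ((l1 + l2) / 2) *\<^sub>R y) ` R) = 1"
      "regular_polygon_at (\<bullet>) n c ((\<lambda>y. ((l1 + l2) / 2) *\<^sub>R y + x) ` R)"
    then show "norm_wrt B c \<le> 263 * sqrt \<epsilon>"
      using assms(5)
      by (intro centre_bound[OF assms(1) nf(8,1,4,3,6,7) centre(2)]) auto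
  qed
qed

end
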